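(* Let $G$ be a finite, simple, connected and planar graph containing at least one cycle, let $H_1,\ldots,H_k$ be the blocks of $G_B$, and let $r \geq 3$ be an integer. Then $r = \mathrm{girth}(G) = \mathrm{circum}(G)$ if and only if one of the following holds: (1) $r$ is even and for every $1 \leq i \leq k$, either $H_i \cong B\left(\frac{r}{2},r,p_i\right)$ for some $p_i \geq 2$ or $H_i \cong C_r$; or (2) $r$ is odd and $H_i \cong C_r$ for every $1 \leq i \leq k$.
   Context: For a graph $G$ containing at least one cycle, $\mathrm{girth}(G)$ and $\mathrm{circum}(G)$ are the lengths of a shortest and of a longest cycle in $G$. $C_r$ is the cycle graph on $r$ vertices. $G_B$ is the graph obtained from $G$ by removing all bridges of $G$ and then removing all isolated vertices. A block of a graph is a maximal connected subgraph that has no cut vertex (a cut vertex of a connected graph being a vertex whose removal disconnects it). Generalised book graph. For $L\ge 3$, $1\le n\le L-2$, $p\ge 2$, the graph $B(n,L,p)$ is the graph obtained from $p$ cycles of length $L$ by gluing them together along a common path of length $n$ (i.e. two vertices joined by $p+1$ internally disjoint paths, one of length $n$ and $p$ of length $L-n$). *)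

theory Defs
  imports "HOL-Analysis.Path_Connected" "Graph_Theory.Graph_Theory"
begin

text \<open>
  Finite simple graphs are the symmetric, loop-free digraphs without parallel arcs of
  \<^locale>\<open>graph\<close> and \<^locale>\<open>pair_graph\<close>: an undirected edge is a pair of opposite arcs.
  The name \<open>connected\<close> is ambiguous here; graph connectivity, which includes
  nonemptiness, is always written \<open>Digraph_Component.connected\<close>.
\<close>

text \<open>
  The bound on the length excludes the closed walks that traverse one edge back and forth,
  which are directed cycles of length 2.
\<close>

definition ugraph_cycle :: "('a, 'b) pre_digraph \<Rightarrow> 'b awalk \<Rightarrow> bool" where
  "ugraph_cycle G c \<longleftrightarrow> pre_digraph.cycle G c \<and> 3 \<le> length c"

text \<open>Both are meaningful only for finite graphs containing a cycle.\<close>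

definition girth :: "('a, 'b) pre_digraph \<Rightarrow> nat" where
  "girth G = Min {length c | c. ugraph_cycle G c}"

definition circum :: "('a, 'b) pre_digraph \<Rightarrow> nat" where
  "circum G = Max {length c | c. ugraph_cycle G c}"

text \<open>
  A drawing without crossings in the plane: \<open>f\<close> places the vertices and \<open>\<gamma> (u, v)\<close> is a simple
  arc from \<open>f u\<close> to \<open>f v\<close>. The two arcs representing one edge trace the same curve.
\<close>

definition planar :: "'a pair_pre_digraph \<Rightarrow> bool" where
  "planar G \<longleftrightarrow> (\<exists>(f :: 'a \<Rightarrow> complex) (\<gamma> :: 'a \<times> 'a \<Rightarrow> real \<Rightarrow> complex).
     inj_on f (pverts G) \<and>
     (\<forall>(u, v) \<in> parcs G.
        arc (\<gamma> (u, v)) \<and> pathstart (\<gamma> (u, v)) = f u \<and> pathfinish (\<gamma> (u, v)) = f v \<and>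
        \<gamma> (v, u) = reversepath (\<gamma> (u, v)) \<and>
        path_image (\<gamma> (u, v)) \<inter> f ` pverts G = {f u, f v}) \<and>
     (\<forall>(u, v) \<in> parcs G. \<forall>(x, y) \<in> parcs G. {u, v} \<noteq> {x, y} \<longrightarrow>
        path_image (\<gamma> (u, v)) \<inter> path_image (\<gamma> (x, y)) \<subseteq> f ` ({u, v} \<inter> {x, y})))"

definition del_edge :: "'a pair_pre_digraph \<Rightarrow> 'a \<times> 'a \<Rightarrow> 'a pair_pre_digraph" where
  "del_edge G e = \<lparr> pverts = pverts G, parcs = parcs G - {e, prod.swap e} \<rparr>"

text \<open>A bridge is an edge whose removal separates its two ends.\<close>

definition bridge :: "'a pair_pre_digraph \<Rightarrow> 'a \<times> 'a \<Rightarrow> bool" where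
  "bridge G e \<longleftrightarrow> e \<in> parcs G \<and> \<not> reachable (with_proj (del_edge G e)) (fst e) (snd e)"

definition del_bridges :: "'a pair_pre_digraph \<Rightarrow> 'a pair_pre_digraph" where
  "del_bridges G = \<lparr> pverts = pverts G, parcs = {e \<in> parcs G. \<not> bridge G e} \<rparr>"

definition del_isolated :: "'a pair_pre_digraph \<Rightarrow> 'a pair_pre_digraph" where
  "del_isolated G =
     \<lparr> pverts = {v \<in> pverts G. \<exists>w. (v, w) \<in> parcs G \<or> (w, v) \<in> parcs G}, parcs = parcs G \<rparr>"

text \<open>The graph written $G_B$.\<close>

definition bridgeless_part :: "'a pair_pre_digraph \<Rightarrow> 'a pair_pre_digraph" where
  "bridgeless_part G = del_isolated (del_bridges G)"

text \<open>The only vertex of a one-vertex graph is not a cut vertex.\<close>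

definition cut_vertex :: "('a, 'b) pre_digraph \<Rightarrow> 'a \<Rightarrow> bool" where
  "cut_vertex G v \<longleftrightarrow> Digraph_Component.connected G \<and> v \<in> verts G \<and> verts G \<noteq> {v} \<and>
     \<not> Digraph_Component.connected (pre_digraph.del_vert G v)"

text \<open>
  The conjunct \<^term>\<open>graph H\<close> is needed because the sub-digraphs of a symmetric digraph need
  not be symmetric.
\<close>

definition block :: "('a, 'b) pre_digraph \<Rightarrow> ('a, 'b) pre_digraph \<Rightarrow> bool" where
  "block G = pre_digraph.max_subgraph G
     (\<lambda>H. graph H \<and> Digraph_Component.connected H \<and> (\<forall>v. \<not> cut_vertex H v))"

text \<open>The cycle $C_r$, for $r \ge 3$.\<close>

definition cycle_graph :: "nat \<Rightarrow> nat pair_pre_digraph" where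
  "cycle_graph r =
     (let A = {(i, Suc i mod r) | i. i < r} in \<lparr> pverts = {..<r}, parcs = A \<union> A\<inverse> \<rparr>)"

text \<open>
  The generalised book graph $B(n,L,p)$, for $L \ge 3$, $1 \le n \le L-2$ and $p \ge 2$. The pair
  \<open>(j, i)\<close> is the \<open>i\<close>-th vertex of the \<open>j\<close>-th of \<open>p\<close> disjoint cycles of length \<open>L\<close>; the copies of
  the path \<open>0, 1, \<dots>, n\<close> in the cycles are identified with the one in cycle 0.
\<close>

definition glue :: "nat \<Rightarrow> nat \<times> nat \<Rightarrow> nat \<times> nat" where
  "glue n = (\<lambda>(j, i). if i \<le> n then (0, i) else (j, i))"

definition book_graph :: "nat \<Rightarrow> nat \<Rightarrow> nat \<Rightarrow> (nat \<times> nat) pair_pre_digraph" where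
  "book_graph n L p =
     (let A = {(glue n (j, i), glue n (j, Suc i mod L)) | j i. j < p \<and> i < L}
      in \<lparr> pverts = glue n ` ({..<p} \<times> {..<L}), parcs = A \<union> A\<inverse> \<rparr>)"

end

theory Submission
  imports Defs
begin

text \<open>
  Every cycle lies in a block of the bridgeless part, and every such block contains a cycle.
  Suppose all cycles of a block have length \<open>r\<close>. If the block is not a single cycle, a cycle has an
  ear, which makes three internally disjoint paths with common ends; any two of them form a cycle,
  so each has length \<open>n = r / 2\<close>. Take a theta graph with as many such paths as possible. An ear from
  \<open>x\<close> to \<open>y\<close> closes every path of the theta graph from \<open>x\<close> to \<open>y\<close> to a cycle of length \<open>2 n\<close>, so
  these paths all have the same length. This happens only if \<open>x\<close> and \<open>y\<close> are the two ends of the theta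
  graph, and then the ear is one more path, against maximality. Hence the block is the theta graph,
  which is a book graph.
\<close>

section \<open>Cycles as vertex lists\<close>

text \<open>Both sides of the theorem are compared with one condition: every cycle of
  \<open>G\<close> has length \<open>r\<close>. Blocks are treated as maximal biconnected subgraphs.
  Single vertices and single edges are biconnected too; they are excluded because every vertex and
  every edge of the bridgeless part lies on a cycle, which a maximal biconnected subgraph must then
  absorb. The search for a largest theta graph has to start from three paths. Two paths form a cycle
  of length \<open>2 * n\<close>, and there any two opposite vertices are joined by paths of equal
  length, so an ear could attach at such a pair instead of at the chosen ends. A third path offers a
  detour whose length rules out every pair except the two ends. Of the \<open>m\<close> equal paths
  one becomes the spine of the book, and each other path closes a cycle with it. This is where
  \<open>p = m - 1 >= 2\<close> and the spine length \<open>r / 2\<close> come from, and it is why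
  an odd \<open>r\<close> leaves only cycles.\<close>

abbreviation walk :: "'a rel \<Rightarrow> 'a list \<Rightarrow> bool" where
  "walk E \<equiv> successively (\<lambda>u v. (u, v) \<in> E)"

abbreviation arcs_cyc :: "'a list \<Rightarrow> 'a rel" where
  "arcs_cyc xs \<equiv> set (zip xs (rotate1 xs))"

text \<open>Vertex lists can be rotated to start anywhere, reversed, and mapped along an injection.
  The first vertex is not repeated at the end; the closing arc is supplied by the wrap-around in
  \<open>rotate1\<close>.\<close>

definition cyc :: "'a rel \<Rightarrow> 'a list \<Rightarrow> bool" where
  "cyc E xs \<longleftrightarrow> 3 \<le> length xs \<and> distinct xs \<and> arcs_cyc xs \<subseteq> E"

lemma walk_iff: "walk E xs \<longleftrightarrow> set (zip xs (tl xs)) \<subseteq> E"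
  by (induction xs rule: induct_list012) auto

lemma walk_converse: "walk (E\<inverse>) xs = walk E (rev xs)"
  by simp

lemma walk_mono: "walk E xs \<Longrightarrow> E \<subseteq> F \<Longrightarrow> walk F xs"
  by (auto simp: walk_iff)

lemma walk_sym_rev: "sym E \<Longrightarrow> walk E xs \<Longrightarrow> walk E (rev xs)"
  by (auto elim!: successively_mono dest: symD)

lemma zip_snoc_tl: "zip xs (tl xs @ [y]) = zip xs (tl xs) @ (if xs = [] then [] else [(last xs, y)])"
  by (induction xs rule: induct_list012) auto

lemma arcs_cyc_conv:
  "xs \<noteq> [] \<Longrightarrow> arcs_cyc xs = insert (last xs, hd xs) (set (zip xs (tl xs)))"
  by (simp add: rotate1_hd_tl zip_snoc_tl)

lemma cyc_iff_walk:
  "cyc E xs \<longleftrightarrow> 3 \<le> length xs \<and> distinct xs \<and> walk E xs \<and> (last xs, hd xs) \<in> E"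
  unfolding cyc_def walk_iff by (cases "xs = []") (auto simp: arcs_cyc_conv)

lemma arcs_cyc_rotate: "arcs_cyc (rotate k xs) = arcs_cyc xs"
proof (induction k)
  case (Suc k)
  have "zip (rotate1 ys) (rotate1 zs) = rotate1 (zip ys zs)" if "length ys = length zs" for ys zs :: "'a list"
    using that by (cases ys; cases zs) auto
  then show ?case using Suc by simp
qed simp

lemma cyc_rotate: "cyc E xs \<Longrightarrow> cyc E (rotate k xs)"
  by (simp add: cyc_def arcs_cyc_rotate)

lemma arcs_cyc_nth: "arcs_cyc xs = {(xs ! i, xs ! (Suc i mod length xs)) | i. i < length xs}"
  by (auto simp: set_zip nth_rotate1)

lemma cyc_mono: "cyc E xs \<Longrightarrow> E \<subseteq> F \<Longrightarrow> cyc F xs"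
  by (auto simp: cyc_def)

lemma cyc_map:
  assumes "cyc E xs" "inj_on h (set xs)" "map_prod h h ` E \<subseteq> F"
  shows "cyc F (map h xs)"
proof -
  have "arcs_cyc (map h xs) = map_prod h h ` arcs_cyc xs"
    by (simp add: rotate1_map zip_map_map map_prod_def)
  then show ?thesis using assms by (fastforce simp: cyc_def distinct_map)
qed

lemma obtain_rotate:
  assumes "x \<in> set xs" obtains k ys where "rotate k xs = x # ys"
proof -
  obtain as bs where "xs = as @ x # bs" using assms by (meson split_list)
  then have "rotate (length as) xs = x # (bs @ as)" by (simp add: rotate_append)
  then show thesis using that by blast
qed

lemma arcs_cyc_through:
  assumes "x \<in> set xs" obtains y z where "(x, y) \<in> arcs_cyc xs" "(z, x) \<in> arcs_cyc xs"
proof -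
  obtain k ys where k: "rotate k xs = x # ys" using assms by (rule obtain_rotate)
  have "\<exists>y. (x, y) \<in> arcs_cyc (x # ys)" by (cases ys) auto
  moreover have "\<exists>z. (z, x) \<in> arcs_cyc (x # ys)" by (subst arcs_cyc_conv) auto
  ultimately show thesis using that arcs_cyc_rotate[of k xs] k by metis
qed

lemma arcs_cyc_in_set: "(x, y) \<in> arcs_cyc xs \<Longrightarrow> x \<in> set xs \<and> y \<in> set xs"
  by (metis set_rotate1 set_zip_leftD set_zip_rightD)

lemma cyc_set_in_Field: "cyc E xs \<Longrightarrow> set xs \<subseteq> Field E"
  by (auto simp: cyc_def Field_def elim: arcs_cyc_through)

section \<open>Closed arc walks and vertex lists\<close>

lemma pcas_zip:
  "pcas u (zip (u # xs) (xs @ [v])) v"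
  by (induction xs arbitrary: u) auto

lemma pcas_zip_fst:
  "pcas u c v \<Longrightarrow> c = zip (map fst c) (tl (map fst c) @ [v])"
proof (induction c arbitrary: u)
  case (Cons e c)
  then show ?case by (cases c) (auto simp: prod_eq_iff)
qed simp

lemma pawalk_verts_conv: "pcas u c v \<Longrightarrow> pawalk_verts u c = map fst c @ [v]"
  by (induction c arbitrary: u) auto

context pair_wf_digraph begin

lemma ugraph_cycle_imp_cyc:
  assumes "ugraph_cycle (with_proj G) c"
  shows "cyc (parcs G) (map fst c)"
proof -
  obtain u where c: "pcas u c u" "set c \<subseteq> parcs G" "distinct (tl (pawalk_verts u c))" "3 \<le> length c"
    using assms by (auto simp: ugraph_cycle_def cycle_def awalk_def)
  obtain e c' where e: "c = e # c'" "fst e = u" using c(1,4) by (cases c) auto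
  \<comment> \<open>The vertices of the closed walk are \<open>map fst c @ [u]\<close>, a list that
    also starts with \<open>u\<close>. Its tail is therefore a rotation of
    \<open>map fst c\<close>.\<close>
  have "distinct (map fst c)" using c(3) unfolding pawalk_verts_conv[OF c(1)] by (auto simp: e)
  moreover have "zip (map fst c) (rotate1 (map fst c)) = c"
    using pcas_zip_fst[OF c(1)] e by simp
  ultimately show ?thesis using c by (simp add: cyc_def)
qed

lemma cyc_imp_ugraph_cycle:
  assumes "cyc (parcs G) xs"
  shows "ugraph_cycle (with_proj G) (zip xs (rotate1 xs))"
proof -
  obtain u ys where xs: "xs = u # ys" using assms by (cases xs) (auto simp: cyc_def)
  have c: "pcas u (zip xs (rotate1 xs)) u" using pcas_zip[of u ys u] xs by simp
  obtain y where "(u, y) \<in> arcs_cyc xs" by (rule arcs_cyc_through[of u xs]) (auto simp: xs)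
  then have "u \<in> pverts G"
    using assms in_arcsD1 by (auto simp: cyc_def)
  moreover have "distinct (tl (pawalk_verts u (zip xs (rotate1 xs))))"
    using assms unfolding pawalk_verts_conv[OF c] by (simp add: cyc_def xs)
  ultimately show ?thesis using assms c
    unfolding ugraph_cycle_def cycle_def awalk_def by (auto simp: cyc_def)
qed

lemma ugraph_cycle_lengths:
  "{length c | c. ugraph_cycle (with_proj G) c} = {length xs | xs. cyc (parcs G) xs}"
proof -
  have "\<exists>xs. length c = length xs \<and> cyc (parcs G) xs" if "ugraph_cycle (with_proj G) c" for c
    using ugraph_cycle_imp_cyc[OF that] by (intro exI[of _ "map fst c"]) simp
  moreover have "\<exists>c. length xs = length c \<and> ugraph_cycle (with_proj G) c" if "cyc (parcs G) xs" for xs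
    using cyc_imp_ugraph_cycle[OF that] by (intro exI[of _ "zip xs (rotate1 xs)"]) simp
  ultimately show ?thesis by blast
qed

end

text \<open>\<open>Min\<close> and \<open>Max\<close> are informative only on a finite nonempty set.
  A cycle repeats no vertex, so the number of vertices bounds its length, and some cycle exists by
  assumption.\<close>

lemma (in pair_fin_digraph) girth_circum_iff:
  assumes "\<exists>c. ugraph_cycle (with_proj G) c"
  shows "r = girth (with_proj G) \<and> girth (with_proj G) = circum (with_proj G) \<longleftrightarrow>
    (\<forall>xs. cyc (parcs G) xs \<longrightarrow> length xs = r)"
proof -
  let ?L = "{length c | c. ugraph_cycle (with_proj G) c}"
  have "?L \<subseteq> {..card (pverts G)}"
  proof -
    have "length xs \<le> card (pverts G)" if "cyc (parcs G) xs" for xs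
    proof -
      have "set xs \<subseteq> pverts G"
        using cyc_set_in_Field[OF that] by (auto simp: Field_def dest: in_arcsD1 in_arcsD2)
      then show ?thesis using that
        by (metis card_mono cyc_def distinct_card pair_finite_verts)
    qed
    then show ?thesis unfolding ugraph_cycle_lengths by auto
  qed
  then have fin: "finite ?L" by (rule finite_subset) simp
  have ne: "?L \<noteq> {}" using assms by blast
  have "Min ?L = r \<and> Max ?L = r \<longleftrightarrow> (\<forall>l\<in>?L. l = r)"
  proof
    assume "Min ?L = r \<and> Max ?L = r"
    then show "\<forall>l\<in>?L. l = r"
      using Min_le[OF fin] Max_ge[OF fin] by (metis (no_types, lifting) le_antisym)
  next
    assume "\<forall>l\<in>?L. l = r"
    then show "Min ?L = r \<and> Max ?L = r"
      using Min_in[OF fin ne] Max_in[OF fin ne] by blast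
  qed
  then show ?thesis
    unfolding girth_def circum_def using ugraph_cycle_lengths by auto
qed

section \<open>Isomorphisms\<close>

text \<open>The arcs on both sides are pairs with the projections as tail and head, so the arc part
  of an isomorphism is determined on the arcs of \<open>K\<close> by the vertex part.\<close>

lemma digraph_iso_with_proj_iff:
  assumes "pair_wf_digraph K"
  shows "digraph_iso (with_proj K) (with_proj B) \<longleftrightarrow>
    (\<exists>h. inj_on h (pverts K) \<and> pverts B = h ` pverts K \<and> parcs B = map_prod h h ` parcs K)"
    (is "?L \<longleftrightarrow> ?R")
proof -
  interpret pair_wf_digraph K by fact
  show ?thesis
  proof
    assume ?L
    then obtain f where f: "digraph_isomorphism f" "with_proj B = app_iso f (with_proj K)"
      by (auto simp: digraph_iso_def)
    have "iso_tail f = fst" "iso_head f = snd"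
      using arg_cong[OF f(2), of tail] arg_cong[OF f(2), of head] by auto
    then have "iso_arcs f a = map_prod (iso_verts f) (iso_verts f) a" if "a \<in> parcs K" for a
      using f(1) that by (auto simp: digraph_isomorphism_def prod_eq_iff)
    then have "parcs B = map_prod (iso_verts f) (iso_verts f) ` parcs K"
      using arg_cong[OF f(2), of arcs] by auto
    then show ?R
      using f(1) arg_cong[OF f(2), of verts] by (auto simp: digraph_isomorphism_def)
  next
    assume ?R
    then obtain h where h: "inj_on h (pverts K)" "pverts B = h ` pverts K"
      "parcs B = map_prod h h ` parcs K" by blast
    let ?f = "\<lparr>iso_verts = h, iso_arcs = map_prod h h, iso_head = snd, iso_tail = fst\<rparr>"
    have "inj_on (map_prod h h) (parcs K)"
      by (rule inj_on_subset[OF map_prod_inj_on[OF h(1) h(1)]]) (auto dest: in_arcsD1 in_arcsD2)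
    then have "digraph_isomorphism ?f"
      using h(1) wf_digraph_axioms by (auto simp: digraph_isomorphism_def)
    moreover have "with_proj B = app_iso ?f (with_proj K)"
      using h by (simp add: app_iso_def with_proj_def)
    ultimately show ?L unfolding digraph_iso_def by blast
  qed
qed

text \<open>The isomorphisms onto cycle graphs and book graphs arise this way: both graphs are
  parametrised by the same indices, and the two parametrisations identify the same indices.\<close>

lemma same_kernel_inj:
  assumes "\<And>a b. a \<in> A \<Longrightarrow> b \<in> A \<Longrightarrow> f a = f b \<longleftrightarrow> g a = g b"
  obtains h where "inj_on h (f ` A)" "\<And>a. a \<in> A \<Longrightarrow> h (f a) = g a"
proof -
  define h where "h = g \<circ> inv_into A f"
  have h: "h (f a) = g a" if "a \<in> A" for a
  proof -
    have "f a \<in> f ` A" using that by blast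
    then have "inv_into A f (f a) \<in> A" "f (inv_into A f (f a)) = f a"
      by (rule inv_into_into, rule f_inv_into_f)
    then show ?thesis using assms[OF _ that] unfolding h_def by simp
  qed
  have "inj_on h (f ` A)"
  proof (rule inj_onI, elim imageE)
    fix x y a b assume eq: "h x = h y" and ab: "x = f a" "a \<in> A" "y = f b" "b \<in> A"
    have "g a = g b" using eq unfolding ab(1,3) h[OF ab(2)] h[OF ab(4)] .
    then show "x = y" unfolding ab(1,3) using assms[OF ab(2,4)] by blast
  qed
  then show thesis using h by (rule that)
qed

section \<open>Connectivity and blocks\<close>

definition conn_on :: "'a set \<Rightarrow> 'a rel \<Rightarrow> bool" where
  "conn_on A E \<longleftrightarrow> (\<forall>u\<in>A. \<forall>v\<in>A. (u, v) \<in> rtrancl_on A E)"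

text \<open>\<open>rtrancl_on\<close> keeps walks inside its set, so deleting a vertex shrinks the
  set while \<open>E\<close> stays as it is. The empty set counts as connected, which makes a single
  vertex biconnected, in agreement with the exemption of one-vertex graphs in
  \<open>cut_vertex\<close>.\<close>

definition biconn :: "'a set \<Rightarrow> 'a rel \<Rightarrow> bool" where
  "biconn V E \<longleftrightarrow> V \<noteq> {} \<and> conn_on V E \<and> (\<forall>x\<in>V. conn_on (V - {x}) E)"

lemma rtrancl_on_restrict: "rtrancl_on A (E \<inter> A \<times> A) = rtrancl_on A E"
proof -
  have "(x, y) \<in> rtrancl_on A (E \<inter> A \<times> A)" if "(x, y) \<in> rtrancl_on A E" for x y
    using that by induct (auto intro: converse_rtrancl_on_into_rtrancl_on)
  then show ?thesis by (auto intro: rtrancl_on_mono[of "E \<inter> A \<times> A" E A A])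
qed

lemma conn_on_restrict: "conn_on A (E \<inter> A \<times> A) = conn_on A E"
  by (simp add: conn_on_def rtrancl_on_restrict)

lemma walk_rtrancl_on:
  "walk E xs \<Longrightarrow> set xs \<subseteq> A \<Longrightarrow> xs \<noteq> [] \<Longrightarrow> (hd xs, last xs) \<in> rtrancl_on A E"
  by (induction xs rule: induct_list012) (auto intro: converse_rtrancl_on_into_rtrancl_on)

lemma rtrancl_on_walk:
  assumes "(u, v) \<in> rtrancl_on A E"
  obtains xs where "xs \<noteq> []" "distinct xs" "walk E xs" "set xs \<subseteq> A" "hd xs = u" "last xs = v"
proof -
  have "\<exists>xs. xs \<noteq> [] \<and> distinct xs \<and> walk E xs \<and> set xs \<subseteq> A \<and> hd xs = u \<and> last xs = v"
    using assms
  proof (induct rule: converse_rtrancl_on_induct)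
    case base
    then show ?case by (intro exI[of _ "[v]"]) auto
  next
    case (step x y)
    then obtain xs where xs: "xs \<noteq> []" "distinct xs" "walk E xs" "set xs \<subseteq> A" "hd xs = y" "last xs = v"
      by blast
    show ?case
    proof (cases "x \<in> set xs")
      case True
      then obtain as bs where "xs = as @ x # bs" by (meson split_list)
      then show ?thesis using xs by (intro exI[of _ "x # bs"]) (auto simp: successively_append_iff)
    next
      case False
      then show ?thesis using xs step by (intro exI[of _ "x # xs"]) (auto simp: successively_Cons)
    qed
  qed
  then show thesis using that by blast
qed

lemma conn_on_union:
  assumes "conn_on A E" "conn_on B F" "A \<inter> B \<noteq> {}"
  shows "conn_on (A \<union> B) (E \<union> F)"
proof -
  obtain z where z: "z \<in> A" "z \<in> B" using assms(3) by blast
  have "(u, z) \<in> rtrancl_on (A \<union> B) (E \<union> F) \<and> (z, u) \<in> rtrancl_on (A \<union> B) (E \<union> F)"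
    if "u \<in> A \<union> B" for u
    using that z assms(1,2) rtrancl_on_mono[of E "E \<union> F" A "A \<union> B"] rtrancl_on_mono[of F "E \<union> F" B "A \<union> B"]
    unfolding conn_on_def by blast
  then show ?thesis unfolding conn_on_def by (blast intro: rtrancl_on_trans)
qed

lemma biconn_conn_on: "biconn V E \<Longrightarrow> conn_on (V - {x}) E"
  by (cases "x \<in> V") (auto simp: biconn_def)

text \<open>After the deletion of any one vertex, \<open>a\<close> or \<open>b\<close> is left to
  hold the two connected remainders together.\<close>

lemma biconn_union:
  assumes "biconn V E" "biconn W F" "a \<noteq> b" "{a, b} \<subseteq> V \<inter> W"
  shows "biconn (V \<union> W) (E \<union> F)"
proof -
  have "conn_on (V \<union> W - {x}) (E \<union> F)" for x
    unfolding Un_Diff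
    by (intro conn_on_union biconn_conn_on[OF assms(1)] biconn_conn_on[OF assms(2)])
      (use assms(3,4) in blast)
  moreover have "conn_on (V \<union> W) (E \<union> F)"
    by (rule conn_on_union) (use assms in \<open>auto simp: biconn_def\<close>)
  ultimately show ?thesis using assms(1) by (auto simp: biconn_def)
qed

lemma walk_conn_on: "walk E xs \<Longrightarrow> sym E \<Longrightarrow> conn_on (set xs) E"
proof (induction xs rule: induct_list012)
  case (3 x y zs)
  have "conn_on {x, y} E"
    using "3.prems" by (auto simp: conn_on_def intro: rtrancl_on_into_rtrancl_on dest: symD)
  from conn_on_union[OF this "3.IH"(2)] "3.prems" show ?case by (auto simp: insert_commute)
qed (auto simp: conn_on_def)

text \<open>With the deleted vertex rotated to the front, the rest of the list is still a
  walk.\<close>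

lemma cyc_biconn:
  assumes "cyc E xs" shows "biconn (set xs) (arcs_cyc xs \<union> (arcs_cyc xs)\<inverse>)"
proof -
  let ?F = "arcs_cyc xs \<union> (arcs_cyc xs)\<inverse>"
  have F: "cyc ?F xs" using assms by (auto simp: cyc_def)
  have sym: "sym ?F" by (rule sym_Un_converse)
  have "conn_on (set xs - {x}) ?F" if x: "x \<in> set xs" for x
  proof -
    obtain k ys where k: "rotate k xs = x # ys" using x by (rule obtain_rotate)
    have "cyc ?F (x # ys)" using cyc_rotate[OF F, of k] k by simp
    then have "walk ?F ys" "distinct (x # ys)" by (auto simp: cyc_iff_walk successively_Cons)
    moreover have "set xs = set (x # ys)" by (metis k set_rotate)
    ultimately show ?thesis using walk_conn_on[OF _ sym] by simp
  qed
  moreover have "conn_on (set xs) ?F" using F walk_conn_on[OF _ sym] by (simp add: cyc_iff_walk)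
  ultimately show ?thesis using assms by (auto simp: biconn_def cyc_def)
qed

lemma connected_with_proj_iff:
  assumes "sym (parcs K)"
  shows "Digraph_Component.connected (with_proj K) \<longleftrightarrow> pverts K \<noteq> {} \<and> conn_on (pverts K) (parcs K)"
proof -
  have "symcl (parcs K) = parcs K" using assms by (auto simp: symcl_def dest: symD)
  then show ?thesis by (simp add: connected_conv conn_on_def)
qed

lemma (in pair_graph) sym_parcs: "sym (parcs G)"
  by (auto intro!: symI arcs_symmetric)

lemma (in pair_graph) biconn_iff:
  "biconn (pverts G) (parcs G) \<longleftrightarrow>
    Digraph_Component.connected (with_proj G) \<and> (\<forall>v. \<not> cut_vertex (with_proj G) v)"
proof -
  let ?D = "\<lambda>v. \<lparr>pverts = pverts G - {v}, parcs = {a \<in> parcs G. fst a \<noteq> v \<and> snd a \<noteq> v}\<rparr>"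
  have del: "pre_digraph.del_vert (with_proj G) v = with_proj (?D v)" for v
    by (simp add: pre_digraph.del_vert_def with_proj_def)
  have "sym (parcs (?D v))" for v using sym_parcs by (auto simp: sym_def)
  note D = connected_with_proj_iff[OF this]
  have "parcs (?D v) = parcs G \<inter> (pverts G - {v}) \<times> (pverts G - {v})" for v
    by (auto dest: in_arcsD1 in_arcsD2)
  then have "Digraph_Component.connected (with_proj (?D v)) \<longleftrightarrow>
      pverts G - {v} \<noteq> {} \<and> conn_on (pverts G - {v}) (parcs G)" for v
    unfolding D by (auto simp: conn_on_restrict)
  then have cut: "cut_vertex (with_proj G) v \<longleftrightarrow> Digraph_Component.connected (with_proj G) \<and>
      v \<in> pverts G \<and> pverts G \<noteq> {v} \<and> \<not> conn_on (pverts G - {v}) (parcs G)" for v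
    unfolding cut_vertex_def del by auto
  have "conn_on (pverts G - {v}) (parcs G)" if "pverts G = {v}" for v
    unfolding that by (simp add: conn_on_def)
  then show ?thesis
    unfolding cut biconn_def connected_with_proj_iff[OF sym_parcs] by blast
qed

section \<open>Blocks as maximal biconnected subgraphs\<close>

definition psub :: "'a pair_pre_digraph \<Rightarrow> 'a pair_pre_digraph \<Rightarrow> bool" where
  "psub K B \<longleftrightarrow> pair_graph K \<and> pverts K \<subseteq> pverts B \<and> parcs K \<subseteq> parcs B"

lemma subgraph_with_proj_iff:
  assumes "pair_graph B"
  shows "graph H \<and> subgraph H (with_proj B) \<longleftrightarrow> (\<exists>K. H = with_proj K \<and> psub K B)"
proof -
  interpret B: pair_graph B by fact
  have "H = with_proj \<lparr>pverts = verts H, parcs = arcs H\<rparr>" if "subgraph H (with_proj B)"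
    using that by (auto simp: subgraph_def compatible_def with_proj_def)
  moreover have "graph (with_proj K)" if "pair_graph K" for K :: "'a pair_pre_digraph"
    using that by (rule pair_graph.pair_graphD_graph)
  moreover have "subgraph (with_proj K) (with_proj B)" if "psub K B" for K
    using that B.wf_digraph_axioms
    by (auto simp: psub_def subgraph_def compatible_def pair_graph_def pair_digraph_def
      pair_fin_digraph_def wf_digraph_wp_iff)
  moreover have "psub K B" if "graph (with_proj K)" "subgraph (with_proj K) (with_proj B)" for K
    using that pair_graphI_graph by (auto simp: psub_def subgraph_def)
  ultimately show ?thesis unfolding psub_def by metis
qed

text \<open>Every candidate for a block, and every competitor in the maximality condition, is a
  symmetric subgraph and hence the projection of a pair graph. Maximality can therefore be tested
  among pair graphs alone.\<close>

lemma block_iff: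
  assumes "pair_graph B"
  shows "block (with_proj B) H \<longleftrightarrow> (\<exists>K. H = with_proj K \<and> psub K B \<and> biconn (pverts K) (parcs K) \<and>
    (\<forall>K'. psub K' B \<and> psub K K' \<and> biconn (pverts K') (parcs K') \<longrightarrow> K' = K))"
proof -
  let ?P = "\<lambda>H. graph H \<and> Digraph_Component.connected H \<and> (\<forall>v. \<not> cut_vertex H v)"
  have inj: "with_proj K = with_proj K' \<Longrightarrow> K = K'" for K K' :: "'a pair_pre_digraph"
    by (cases K; cases K') (simp add: with_proj_def)
  have P: "subgraph H (with_proj B) \<and> ?P H \<longleftrightarrow>
      (\<exists>K. H = with_proj K \<and> psub K B \<and> biconn (pverts K) (parcs K))" for H
    using subgraph_with_proj_iff[OF assms, of H] pair_graph.biconn_iff unfolding psub_def by blast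
  have S: "subgraph (with_proj K) (with_proj K') \<longleftrightarrow> psub K K'"
    if "psub K B" "psub K' B" for K K'
  proof -
    have K: "pair_graph K" "pair_graph K'" using that by (auto simp: psub_def)
    show ?thesis
      using subgraph_with_proj_iff[OF K(2), of "with_proj K"] pair_graph.pair_graphD_graph[OF K(1)] inj
      by blast
  qed
  show ?thesis
  proof
    assume "block (with_proj B) H"
    then have H: "subgraph H (with_proj B) \<and> ?P H"
      and max: "\<And>H'. H' \<noteq> H \<Longrightarrow> subgraph H H' \<Longrightarrow> \<not> (subgraph H' (with_proj B) \<and> ?P H')"
      unfolding block_def pre_digraph.max_subgraph_def by blast+
    obtain K where K: "H = with_proj K" "psub K B" "biconn (pverts K) (parcs K)"
      using H P by blast
    have "K' = K" if K': "psub K' B" "psub K K'" "biconn (pverts K') (parcs K')" for K'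
    proof -
      have "subgraph (with_proj K') (with_proj B) \<and> ?P (with_proj K')"
        unfolding P using K'(1,3) by blast
      moreover have "subgraph H (with_proj K')" using K S[of K K'] K' by simp
      ultimately show ?thesis using max[of "with_proj K'"] inj[of K' K] K(1) by blast
    qed
    then show "\<exists>K. H = with_proj K \<and> psub K B \<and> biconn (pverts K) (parcs K) \<and>
      (\<forall>K'. psub K' B \<and> psub K K' \<and> biconn (pverts K') (parcs K') \<longrightarrow> K' = K)"
      using K by blast
  next
    assume "\<exists>K. H = with_proj K \<and> psub K B \<and> biconn (pverts K) (parcs K) \<and>
      (\<forall>K'. psub K' B \<and> psub K K' \<and> biconn (pverts K') (parcs K') \<longrightarrow> K' = K)"
    then obtain K where K: "H = with_proj K" "psub K B" "biconn (pverts K) (parcs K)"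
      and max: "\<And>K'. psub K' B \<Longrightarrow> psub K K' \<Longrightarrow> biconn (pverts K') (parcs K') \<Longrightarrow> K' = K"
      by blast
    have "H' = H" if H': "subgraph H H'" "subgraph H' (with_proj B) \<and> ?P H'" for H'
    proof -
      obtain K' where K': "H' = with_proj K'" "psub K' B" "biconn (pverts K') (parcs K')"
        using H'(2) unfolding P by blast
      then show ?thesis using max[of K'] S[of K K'] K H'(1) by simp
    qed
    moreover have "subgraph H (with_proj B) \<and> ?P H" unfolding P using K by blast
    ultimately show "block (with_proj B) H"
      unfolding block_def pre_digraph.max_subgraph_def by blast
  qed
qed

text \<open>The number of vertices plus the number of arcs is bounded by that of \<open>B\<close>
  and grows under proper inclusion, so a biconnected extension of \<open>K\<close> with the largest
  sum is maximal.\<close>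

lemma ex_block_above:
  assumes "pair_graph B" "psub K B" "biconn (pverts K) (parcs K)"
  obtains K' where "block (with_proj B) (with_proj K')" "psub K K'" "pair_graph K'"
proof -
  interpret B: pair_graph B by fact
  let ?P = "\<lambda>K'. psub K' B \<and> psub K K' \<and> biconn (pverts K') (parcs K')"
  let ?m = "\<lambda>K'. card (pverts K') + card (parcs K')"
  have "?m K' < Suc (card (pverts B) + card (parcs B))" if "?P K'" for K'
    using that card_mono[OF B.pair_finite_verts, of "pverts K'"] card_mono[OF B.pair_finite_arcs, of "parcs K'"]
    by (auto simp: psub_def)
  moreover have "?P K" using assms by (auto simp: psub_def)
  ultimately obtain K' where K': "?P K'" "\<And>L. ?P L \<Longrightarrow> ?m L \<le> ?m K'"
    using ex_has_greatest_nat[of ?P K ?m "Suc (card (pverts B) + card (parcs B))"] by blast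
  have "L = K'" if L: "psub L B" "psub K' L" "biconn (pverts L) (parcs L)" for L
  proof -
    have sub: "pverts K' \<subseteq> pverts L" "parcs K' \<subseteq> parcs L" using L(2) by (auto simp: psub_def)
    have fin: "finite (pverts L)" "finite (parcs L)"
      using L(1) B.pair_finite_verts B.pair_finite_arcs by (auto simp: psub_def intro: finite_subset)
    have "?m L \<le> ?m K'" by (rule K'(2)) (use K'(1) L in \<open>auto simp: psub_def\<close>)
    then have "card (pverts L) = card (pverts K')" "card (parcs L) = card (parcs K')"
      using card_mono[OF fin(1) sub(1)] card_mono[OF fin(2) sub(2)] by linarith+
    then have "pverts K' = pverts L" "parcs K' = parcs L"
      using card_subset_eq[OF fin(1) sub(1)] card_subset_eq[OF fin(2) sub(2)] by simp_all
    then show ?thesis by simp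
  qed
  then have "block (with_proj B) (with_proj K')" using K'(1) block_iff[OF assms(1)] by blast
  then show thesis using that K'(1) by (auto simp: psub_def)
qed

section \<open>Cycles, bridges and the blocks of the bridgeless part\<close>

definition cycle_sub :: "'a list \<Rightarrow> 'a pair_pre_digraph" where
  "cycle_sub xs = \<lparr>pverts = set xs, parcs = arcs_cyc xs \<union> (arcs_cyc xs)\<inverse>\<rparr>"

context pair_graph begin

lemma pair_graph_sub:
  assumes "V \<subseteq> pverts G" "E \<subseteq> parcs G" "sym E" "E \<subseteq> V \<times> V"
  shows "pair_graph \<lparr>pverts = V, parcs = E\<rparr>"
proof -
  have "finite V" "finite E"
    using assms pair_finite_verts pair_finite_arcs by (auto intro: finite_subset)
  then show ?thesis
    using assms no_loops' by unfold_locales (auto simp: symmetric_def)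
qed

lemma psub_cycle_sub:
  assumes "cyc (parcs G) xs"
  shows "psub (cycle_sub xs) G"
proof -
  have "set xs \<subseteq> pverts G"
    using cyc_set_in_Field[OF assms] by (auto simp: Field_def dest: in_arcsD1 in_arcsD2)
  moreover have "arcs_cyc xs \<union> (arcs_cyc xs)\<inverse> \<subseteq> parcs G"
    using assms arcs_symmetric by (auto simp: cyc_def)
  moreover have "arcs_cyc xs \<union> (arcs_cyc xs)\<inverse> \<subseteq> set xs \<times> set xs"
    by (auto dest!: arcs_cyc_in_set)
  ultimately show ?thesis
    unfolding psub_def cycle_sub_def using pair_graph_sub[OF _ _ sym_Un_converse] by simp
qed

text \<open>The rest of the cycle joins the two ends without the arc. Rotated to start at
  \<open>v\<close>, the list ends at \<open>u\<close>, and its reverse is the required walk from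
  \<open>u\<close> to \<open>v\<close>.\<close>

lemma cyc_arc_not_bridge:
  assumes "cyc (parcs G) xs" "(u, v) \<in> arcs_cyc xs"
  shows "\<not> bridge G (u, v)"
proof -
  let ?F = "parcs G - {(u, v), (v, u)}"
  obtain k ys where k: "rotate k xs = v # ys"
    using arcs_cyc_in_set[OF assms(2)] obtain_rotate by metis
  have c: "cyc (parcs G) (v # ys)" using cyc_rotate[OF assms(1), of k] k by simp
  then have d: "v \<notin> set ys" "distinct ys" "2 \<le> length ys" and w: "walk (parcs G) (v # ys)"
    by (auto simp: cyc_iff_walk)
  have "(u, v) \<in> arcs_cyc (v # ys)" using assms(2) arcs_cyc_rotate[of k xs] k by simp
  then have u: "u = last ys"
    using d by (subst (asm) arcs_cyc_conv) (auto dest: set_zip_rightD)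
  obtain w zs where ys: "ys = w # zs" "zs \<noteq> []" using d(3) by (cases ys; cases "tl ys") auto
  \<comment> \<open>\<open>v\<close> occurs only at the front and is followed by \<open>w\<close>,
    which differs from \<open>u\<close>, the last entry of a list \<open>ys\<close> of length at
    least 2.\<close>
  have "(v, u) \<notin> set (zip (v # ys) ys)" "(u, v) \<notin> set (zip (v # ys) ys)"
    using d u ys by (auto dest: set_zip_leftD set_zip_rightD)
  then have "walk ?F (v # ys)" using w unfolding walk_iff by auto
  then have "walk ?F (rev (v # ys))"
    by (rule walk_sym_rev[rotated]) (use sym_parcs in \<open>auto simp: sym_def\<close>)
  moreover have "set (v # ys) \<subseteq> pverts G"
    using cyc_set_in_Field[OF c] by (auto simp: Field_def dest: in_arcsD1 in_arcsD2)
  ultimately have "(hd (rev (v # ys)), last (rev (v # ys))) \<in> rtrancl_on (pverts G) ?F"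
    by (intro walk_rtrancl_on) auto
  then show ?thesis
    using u ys by (simp add: bridge_def del_edge_def reachable_def hd_append hd_rev)
qed

lemma not_bridge_in_cyc:
  assumes "(u, v) \<in> parcs G" "\<not> bridge G (u, v)"
  obtains xs where "cyc (parcs G) xs" "(u, v) \<in> arcs_cyc xs"
proof -
  let ?F = "parcs G - {(u, v), (v, u)}"
  have "(u, v) \<in> rtrancl_on (pverts G) ?F"
    using assms by (simp add: bridge_def del_edge_def reachable_def)
  then obtain xs where xs: "xs \<noteq> []" "distinct xs" "walk ?F xs" "hd xs = u" "last xs = v"
    by (rule rtrancl_on_walk)
  have "u \<noteq> v" using assms(1) no_loops' by blast
  then obtain x ys where "xs = u # x # ys" using xs(1,4,5) by (cases xs; cases "tl xs") auto
  \<comment> \<open>A path with only two vertices would use the deleted arc from \<open>u\<close> to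
    \<open>v\<close>.\<close>
  then have "3 \<le> length xs" using xs(3,5) by (cases ys) auto
  moreover have "walk (parcs G) (rev xs)"
    using walk_sym_rev[OF sym_parcs] walk_mono[OF xs(3)] by blast
  \<comment> \<open>The path is reversed so that the closing arc, from the last entry to the first,
    is \<open>(u, v)\<close> and not \<open>(v, u)\<close>.\<close>
  ultimately have "cyc (parcs G) (rev xs)"
    using xs assms(1) by (auto simp: cyc_iff_walk hd_rev last_rev)
  moreover have "(u, v) \<in> arcs_cyc (rev xs)"
    using xs by (subst arcs_cyc_conv) (auto simp: hd_rev last_rev)
  ultimately show thesis by (rule that)
qed

text \<open>This removes bridges from the rest of the argument: an arc whose ends stay connected
  without it closes a path to a cycle, and deleting isolated vertices keeps all arcs.\<close>

lemma parcs_bridgeless_part: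
  "parcs (bridgeless_part G) = (\<Union>xs\<in>{xs. cyc (parcs G) xs}. arcs_cyc xs)"
proof -
  have "(u, v) \<in> parcs G \<and> \<not> bridge G (u, v) \<longleftrightarrow> (\<exists>xs. cyc (parcs G) xs \<and> (u, v) \<in> arcs_cyc xs)" for u v
  proof
    assume "(u, v) \<in> parcs G \<and> \<not> bridge G (u, v)"
    then show "\<exists>xs. cyc (parcs G) xs \<and> (u, v) \<in> arcs_cyc xs" using not_bridge_in_cyc by blast
  next
    assume "\<exists>xs. cyc (parcs G) xs \<and> (u, v) \<in> arcs_cyc xs"
    then show "(u, v) \<in> parcs G \<and> \<not> bridge G (u, v)"
      using cyc_arc_not_bridge unfolding cyc_def by blast
  qed
  then show ?thesis
    unfolding bridgeless_part_def del_isolated_def del_bridges_def by auto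
qed

lemma cyc_bridgeless_part_iff: "cyc (parcs (bridgeless_part G)) xs \<longleftrightarrow> cyc (parcs G) xs"
proof
  assume "cyc (parcs (bridgeless_part G)) xs"
  then show "cyc (parcs G) xs"
    by (rule cyc_mono) (auto simp: parcs_bridgeless_part cyc_def)
next
  assume "cyc (parcs G) xs"
  then show "cyc (parcs (bridgeless_part G)) xs"
    unfolding parcs_bridgeless_part by (auto simp: cyc_def)
qed

lemma pair_graph_bridgeless_part: "pair_graph (bridgeless_part G)"
proof -
  let ?B = "bridgeless_part G"
  have sub: "parcs ?B \<subseteq> parcs G"
    by (auto simp: parcs_bridgeless_part cyc_def)
  have "(v, u) \<in> parcs ?B" if uv: "(u, v) \<in> parcs ?B" for u v
  proof -
    obtain xs where xs: "cyc (parcs G) xs" "(u, v) \<in> arcs_cyc xs"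
      using uv by (auto simp: parcs_bridgeless_part)
    have "xs \<noteq> []" using xs by auto
    have rev: "set (zip (rev ys) (tl (rev ys))) = (set (zip ys (tl ys)))\<inverse>" for ys :: "'a list"
    proof -
      \<comment> \<open>By \<open>walk_iff\<close> an inclusion of arc sets says that a list is a
        walk. Taking for \<open>A\<close> each side of the claimed equation gives the two
        inclusions.\<close>
      have "set (zip (rev ys) (tl (rev ys))) \<subseteq> A \<longleftrightarrow> set (zip ys (tl ys)) \<subseteq> A\<inverse>" for A
        using walk_iff[of A "rev ys"] walk_iff[of "A\<inverse>" ys] walk_converse[of A ys] by blast
      from this[of "set (zip (rev ys) (tl (rev ys)))"] this[of "(set (zip ys (tl ys)))\<inverse>"]
      show ?thesis by auto
    qed
    have "arcs_cyc (rev xs) = (arcs_cyc xs)\<inverse>"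
      using \<open>xs \<noteq> []\<close> arcs_cyc_conv[of xs] arcs_cyc_conv[of "rev xs"] unfolding rev
      by (auto simp: hd_rev last_rev)
    moreover have "cyc (parcs G) (rev xs)"
      using xs(1) \<open>arcs_cyc (rev xs) = _\<close> arcs_symmetric unfolding cyc_def by auto
    ultimately show ?thesis using xs(2) by (auto simp: parcs_bridgeless_part)
  qed
  then have "sym (parcs ?B)" by (rule symI)
  moreover have "pverts ?B \<subseteq> pverts G" "parcs ?B \<subseteq> pverts ?B \<times> pverts ?B"
    by (auto simp: bridgeless_part_def del_isolated_def del_bridges_def dest: in_arcsD1 in_arcsD2)
  ultimately have "pair_graph \<lparr>pverts = pverts ?B, parcs = parcs ?B\<rparr>"
    by (intro pair_graph_sub sub)
  moreover have "\<lparr>pverts = pverts ?B, parcs = parcs ?B\<rparr> = ?B" by simp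
  ultimately show ?thesis by (simp only:)
qed

lemma biconn_cycle_sub:
  "cyc E xs \<Longrightarrow> biconn (pverts (cycle_sub xs)) (parcs (cycle_sub xs))"
  by (simp add: cycle_sub_def cyc_biconn)

lemma block_of_cyc:
  assumes "cyc (parcs G) xs"
  obtains K where "block (with_proj (bridgeless_part G)) (with_proj K)" "pair_graph K"
    "cyc (parcs K) xs"
proof -
  interpret B: pair_graph "bridgeless_part G" by (rule pair_graph_bridgeless_part)
  have "psub (cycle_sub xs) (bridgeless_part G)"
    using assms B.psub_cycle_sub cyc_bridgeless_part_iff by blast
  from ex_block_above[OF pair_graph_bridgeless_part this biconn_cycle_sub[OF assms]]
  obtain K where K: "block (with_proj (bridgeless_part G)) (with_proj K)" "pair_graph K"
    "psub (cycle_sub xs) K" by blast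
  then have "cyc (parcs K) xs" using assms by (auto simp: cyc_def psub_def cycle_sub_def)
  then show thesis using that K by blast
qed

text \<open>Biconnectivity alone does not yield a cycle, but every vertex and arc of the bridgeless
  part lies on one, and maximality forces the block to contain it.\<close>

lemma block_bridgeless_partE:
  assumes "block (with_proj (bridgeless_part G)) H"
  obtains K xs where "H = with_proj K" "psub K G" "biconn (pverts K) (parcs K)" "cyc (parcs K) xs"
proof -
  let ?B = "bridgeless_part G"
  interpret B: pair_graph ?B by (rule pair_graph_bridgeless_part)
  obtain K where K: "H = with_proj K" "psub K ?B" "biconn (pverts K) (parcs K)"
    and max: "\<And>K'. psub K' ?B \<Longrightarrow> psub K K' \<Longrightarrow> biconn (pverts K') (parcs K') \<Longrightarrow> K' = K"
    using assms block_iff[OF pair_graph_bridgeless_part] by blast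
  interpret K: pair_graph K using K(2) by (simp add: psub_def)
  have "\<exists>xs. cyc (parcs K) xs"
  proof (cases "parcs K = {}")
    case True
    \<comment> \<open>Without arcs a connected graph is a single vertex, which is contained in any
      cycle through it.\<close>
    obtain v where v: "v \<in> pverts K" using K(3) by (auto simp: biconn_def)
    have "pverts K \<subseteq> {v}"
    proof
      fix u assume "u \<in> pverts K"
      then have "(u, v) \<in> rtrancl_on (pverts K) {}"
        using K(3) v True by (auto simp: biconn_def conn_on_def)
      then show "u \<in> {v}" by cases auto
    qed
    moreover obtain xs where xs: "cyc (parcs ?B) xs" "v \<in> set xs"
    proof -
      have "v \<in> pverts ?B" using v K(2) by (auto simp: psub_def)
      then obtain w where "(v, w) \<in> parcs ?B \<or> (w, v) \<in> parcs ?B"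
        by (auto simp: bridgeless_part_def del_isolated_def)
      then obtain xs where "cyc (parcs G) xs" "v \<in> set xs"
        unfolding parcs_bridgeless_part using arcs_cyc_in_set by fast
      then show thesis using that cyc_bridgeless_part_iff by blast
    qed
    ultimately have "psub K (cycle_sub xs)"
      using True B.psub_cycle_sub[OF xs(1)] K.pair_graph by (auto simp: psub_def cycle_sub_def)
    then have "cycle_sub xs = K"
      by (rule max[OF B.psub_cycle_sub[OF xs(1)] _ biconn_cycle_sub[OF xs(1)]])
    then have "cyc (parcs K) xs" using xs(1) by (auto simp: cyc_def cycle_sub_def)
    then show ?thesis ..
  next
    case False
    then obtain a b where ab: "(a, b) \<in> parcs K" by fast
    have "a \<noteq> b" "a \<in> pverts K" "b \<in> pverts K"
      using ab K.no_loops' K.in_arcsD1 K.in_arcsD2 by auto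
    obtain xs where xs: "cyc (parcs ?B) xs" "(a, b) \<in> arcs_cyc xs"
    proof -
      have "(a, b) \<in> parcs ?B" using ab K(2) by (auto simp: psub_def)
      then obtain xs where "cyc (parcs G) xs" "(a, b) \<in> arcs_cyc xs"
        by (auto simp: parcs_bridgeless_part)
      then show thesis using that cyc_bridgeless_part_iff by blast
    qed
    \<comment> \<open>The block and the cycle share the two ends of the arc, so
      \<open>biconn_union\<close> makes their union biconnected, and maximality identifies the union
      with the block.\<close>
    let ?C = "cycle_sub xs"
    let ?U = "\<lparr>pverts = pverts K \<union> pverts ?C, parcs = parcs K \<union> parcs ?C\<rparr>"
    have C: "psub ?C ?B" by (rule B.psub_cycle_sub[OF xs(1)])
    have "biconn (pverts ?U) (parcs ?U)"
      using biconn_union[OF K(3) biconn_cycle_sub[OF xs(1)] \<open>a \<noteq> b\<close>] arcs_cyc_in_set[OF xs(2)]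
        \<open>a \<in> pverts K\<close> \<open>b \<in> pverts K\<close>
      by (simp add: cycle_sub_def)
    moreover have "pair_graph ?U"
    proof (rule B.pair_graph_sub)
      interpret C: pair_graph ?C using C by (simp add: psub_def)
      show "sym (parcs K \<union> parcs ?C)" using K.sym_parcs C.sym_parcs by (rule sym_Un)
      show "parcs K \<union> parcs ?C \<subseteq> (pverts K \<union> pverts ?C) \<times> (pverts K \<union> pverts ?C)"
        by (auto dest: K.in_arcsD1 K.in_arcsD2 C.in_arcsD1 C.in_arcsD2)
    qed (use C K(2) in \<open>auto simp: psub_def\<close>)
    ultimately have "?U = K"
      using C K(2) by (intro max) (auto simp: psub_def)
    then have "parcs ?U = parcs K" by (rule arg_cong)
    then have "parcs ?C \<subseteq> parcs K" by auto
    then have "cyc (parcs K) xs" using xs(1) by (auto simp: cyc_def cycle_sub_def)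
    then show ?thesis ..
  qed
  then obtain xs where xs: "cyc (parcs K) xs" ..
  have "pverts ?B \<subseteq> pverts G" "parcs ?B \<subseteq> parcs G"
    by (auto simp: bridgeless_part_def del_isolated_def del_bridges_def)
  then have "psub K G" using K(2) unfolding psub_def by blast
  from that[OF K(1) this K(3) xs] show thesis .
qed

end

section \<open>Theta graphs\<close>

text \<open>
  \<open>m\<close> paths of length \<open>n\<close> with common ends and otherwise disjoint: \<open>Q j i\<close> is the \<open>i\<close>-th vertex
  of path \<open>j\<close>. The only identifications are those at the ends \<open>i = 0\<close> and \<open>i = n\<close>.
\<close>

definition theta :: "nat \<Rightarrow> nat \<Rightarrow> (nat \<Rightarrow> nat \<Rightarrow> 'a) \<Rightarrow> bool" where
  "theta n m Q \<longleftrightarrow> (\<forall>j<m. \<forall>k<m. \<forall>i\<le>n. \<forall>l\<le>n. Q j i = Q k l \<longleftrightarrow> i = l \<and> (j = k \<or> i = 0 \<or> i = n))"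

definition theta_verts :: "nat \<Rightarrow> nat \<Rightarrow> (nat \<Rightarrow> nat \<Rightarrow> 'a) \<Rightarrow> 'a set" where
  "theta_verts n m Q = (\<lambda>(j, i). Q j i) ` ({..<m} \<times> {..n})"

definition theta_arcs :: "nat \<Rightarrow> nat \<Rightarrow> (nat \<Rightarrow> nat \<Rightarrow> 'a) \<Rightarrow> 'a rel" where
  "theta_arcs n m Q = (\<lambda>(j, i). (Q j i, Q j (Suc i))) ` ({..<m} \<times> {..<n})"

definition theta_edges :: "nat \<Rightarrow> nat \<Rightarrow> (nat \<Rightarrow> nat \<Rightarrow> 'a) \<Rightarrow> 'a rel" where
  "theta_edges n m Q = theta_arcs n m Q \<union> (theta_arcs n m Q)\<inverse>"

lemma thetaD:
  "theta n m Q \<Longrightarrow> j < m \<Longrightarrow> k < m \<Longrightarrow> i \<le> n \<Longrightarrow> l \<le> n \<Longrightarrow>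
    Q j i = Q k l \<longleftrightarrow> i = l \<and> (j = k \<or> i = 0 \<or> i = n)"
  unfolding theta_def by blast

lemma theta_vertsI: "j < m \<Longrightarrow> i \<le> n \<Longrightarrow> Q j i \<in> theta_verts n m Q"
  by (force simp: theta_verts_def)

lemma theta_edgesI:
  "j < m \<Longrightarrow> i < n \<Longrightarrow> (Q j i, Q j (Suc i)) \<in> theta_edges n m Q"
  "j < m \<Longrightarrow> i < n \<Longrightarrow> (Q j (Suc i), Q j i) \<in> theta_edges n m Q"
  by (force simp: theta_edges_def theta_arcs_def)+

lemma theta_edgesE:
  assumes "(u, v) \<in> theta_edges n m Q"
  obtains j i where "j < m" "i < n" "u = Q j i" "v = Q j (Suc i)"
    | j i where "j < m" "i < n" "v = Q j i" "u = Q j (Suc i)"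
  using assms by (auto simp: theta_edges_def theta_arcs_def)

lemma sym_theta_edges: "sym (theta_edges n m Q)"
  unfolding theta_edges_def by (rule sym_Un_converse)

lemma theta_edges_subset: "theta_edges n m Q \<subseteq> theta_verts n m Q \<times> theta_verts n m Q"
  by (auto elim!: theta_edgesE intro: theta_vertsI)

text \<open>\<open>theta\<close> prescribes exactly which index pairs coincide, so two theta graphs
  with the same parameters have the same kernel.\<close>

lemma theta_iso:
  assumes "theta n m Q" "theta n m R"
  obtains h where "inj_on h (theta_verts n m Q)" "theta_verts n m R = h ` theta_verts n m Q"
    "theta_edges n m R = map_prod h h ` theta_edges n m Q"
proof -
  let ?A = "{..<m} \<times> {..n}"
  have "(case a of (j, i) \<Rightarrow> Q j i) = (case b of (j, i) \<Rightarrow> Q j i) \<longleftrightarrow>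
    (case a of (j, i) \<Rightarrow> R j i) = (case b of (j, i) \<Rightarrow> R j i)" if "a \<in> ?A" "b \<in> ?A" for a b
    using that thetaD[OF assms(1)] thetaD[OF assms(2)] by (cases a; cases b) auto
  then obtain h where h: "inj_on h ((\<lambda>(j, i). Q j i) ` ?A)"
    "\<And>a. a \<in> ?A \<Longrightarrow> h (case a of (j, i) \<Rightarrow> Q j i) = (case a of (j, i) \<Rightarrow> R j i)"
    using same_kernel_inj[of ?A "\<lambda>(j, i). Q j i" "\<lambda>(j, i). R j i"] by blast
  have hQ: "h (Q j i) = R j i" if "j < m" "i \<le> n" for j i
    using h(2)[of "(j, i)"] that by simp
  have "theta_arcs n m R = map_prod h h ` theta_arcs n m Q"
    unfolding theta_arcs_def image_image by (rule image_cong) (auto simp: hQ)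
  then have "theta_edges n m R = map_prod h h ` theta_edges n m Q"
    unfolding theta_edges_def by (auto simp: image_Un)
  moreover have "theta_verts n m R = h ` theta_verts n m Q"
    unfolding theta_verts_def image_image by (rule image_cong) (auto simp: hQ)
  ultimately show thesis using that h(1) unfolding theta_verts_def by blast
qed

section \<open>Cycle lengths in cycle graphs and theta graphs\<close>

text \<open>With \<open>v\<close> rotated to the front, its neighbours are the second and the last
  entry, and these differ because the length is at least 3.\<close>

lemma cyc_nbrs:
  assumes "cyc E xs" "v \<in> set xs"
  obtains a b where "a \<noteq> b" "(arcs_cyc xs \<union> (arcs_cyc xs)\<inverse>) `` {v} = {a, b}"
proof -
  obtain k ys where k: "rotate k xs = v # ys" using assms(2) by (rule obtain_rotate)
  have "cyc E (v # ys)" using cyc_rotate[OF assms(1), of k] k by simp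
  then have d: "v \<notin> set ys" "distinct ys" "2 \<le> length ys" by (auto simp: cyc_def)
  then obtain a zs where ys: "ys = a # zs" "zs \<noteq> []" by (cases ys; cases "tl ys") auto
  have "arcs_cyc xs = arcs_cyc (v # ys)" using arcs_cyc_rotate[of k xs] k by simp
  also have "\<dots> = insert (last zs, v) (insert (v, a) (set (zip ys zs)))"
    using arcs_cyc_conv[of "v # ys"] ys by simp
  finally have eq: "arcs_cyc xs = insert (last zs, v) (insert (v, a) (set (zip ys zs)))" .
  have "x \<in> set ys \<and> y \<in> set ys" if "(x, y) \<in> set (zip ys zs)" for x y
    using that ys by (auto dest: set_zip_leftD set_zip_rightD)
  then have "x \<noteq> v \<and> y \<noteq> v" if "(x, y) \<in> set (zip ys zs)" for x y
    using that d(1) by blast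
  then have "(arcs_cyc xs \<union> (arcs_cyc xs)\<inverse>) `` {v} = {a, last zs}"
    unfolding eq by blast
  moreover have "a \<noteq> last zs" using d ys by auto
  ultimately show thesis using that by blast
qed

text \<open>A cycle through a vertex with at most two neighbours has no choice there. This drives a
  cycle along the whole of a path once it enters the interior.\<close>

lemma cyc_nbrs_eq:
  assumes "cyc E xs" "sym E" "v \<in> set xs" "E `` {v} \<subseteq> {a, b}"
  shows "(arcs_cyc xs \<union> (arcs_cyc xs)\<inverse>) `` {v} = {a, b}"
proof -
  obtain c d where cd: "c \<noteq> d" "(arcs_cyc xs \<union> (arcs_cyc xs)\<inverse>) `` {v} = {c, d}"
    using assms(1,3) by (rule cyc_nbrs)
  have "(arcs_cyc xs \<union> (arcs_cyc xs)\<inverse>) `` {v} \<subseteq> E `` {v}"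
    using assms(1,2) by (auto simp: cyc_def dest: symD)
  then have "{c, d} \<subseteq> {a, b}" using assms(4) cd(2) by auto
  then show ?thesis using cd by auto
qed

text \<open>If the cycle missed the successor of one of its vertices, both neighbours of that vertex
  on the cycle would be its predecessor modulo \<open>r\<close>, which is unique. So the vertex set
  of the cycle is closed under successors and contains everything.\<close>

lemma cycle_graph_cyc_length:
  assumes c: "cyc (parcs (cycle_graph r)) xs"
  shows "length xs = r"
proof -
  let ?F = "arcs_cyc xs \<union> (arcs_cyc xs)\<inverse>"
  have E: "parcs (cycle_graph r) = {(i, Suc i mod r) | i. i < r} \<union> {(i, Suc i mod r) | i. i < r}\<inverse>"
    by (simp add: cycle_graph_def Let_def)
  have F: "?F \<subseteq> parcs (cycle_graph r)"
    using c unfolding cyc_def E by blast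
  have lt: "v < r" if "v \<in> set xs" for v
    using cyc_set_in_Field[OF c] that unfolding E Field_def by (auto intro: mod_less_divisor gr_zeroI)
  have step: "Suc v mod r \<in> set xs" if v: "v \<in> set xs" for v
  proof (rule ccontr)
    assume no: "Suc v mod r \<notin> set xs"
    obtain a b where ab: "a \<noteq> b" "?F `` {v} = {a, b}" using c v by (rule cyc_nbrs)
    have "x < r \<and> Suc x mod r = v" if "x \<in> ?F `` {v}" for x
    proof -
      have "x \<in> set xs" using that by (auto dest: arcs_cyc_in_set)
      moreover have "(v, x) \<in> parcs (cycle_graph r)" using that F by blast
      ultimately show ?thesis using no unfolding E by auto
    qed
    from this[of a] this[of b] ab show False
      by (auto simp: mod_Suc split: if_splits)
  qed
  obtain v where v: "v \<in> set xs" using c by (cases xs) (auto simp: cyc_def)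
  have "(v + k) mod r \<in> set xs" for k
  proof (induction k)
    case 0
    then show ?case using v lt by simp
  next
    case (Suc k)
    then show ?case using step[OF Suc] by (simp add: mod_Suc_eq)
  qed
  moreover have "\<exists>k. (v + k) mod r = u" if "u < r" for u
    using lt[OF v] that by (intro exI[of _ "r - v + u"]) simp
  ultimately have "set xs = {..<r}" using lt by fastforce
  then show ?thesis using c distinct_card[of xs] by (simp add: cyc_def)
qed

text \<open>
  A cycle contains a path of the theta graph as soon as it contains one of its inner vertices,
  so it is the union of as many paths as it uses edges at an end of the paths, that is, of two.
\<close>

lemma theta_cyc_length:
  assumes th: "theta n m Q" and n: "2 \<le> n" and c: "cyc (theta_edges n m Q) xs"
  shows "length xs = 2 * n"
proof -
  let ?E = "theta_edges n m Q"
  let ?F = "arcs_cyc xs \<union> (arcs_cyc xs)\<inverse>"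
  note Q = thetaD[OF th]
  have F: "?F \<subseteq> ?E" using c sym_theta_edges[of n m Q] unfolding cyc_def by (blast dest: symD)
  have FS: "u \<in> set xs \<and> v \<in> set xs" if "(u, v) \<in> ?F" for u v
    using that by (auto dest: arcs_cyc_in_set)
  have inner: "?F `` {Q j (Suc i)} = {Q j i, Q j (Suc (Suc i))}"
    if "j < m" "Suc i < n" "Q j (Suc i) \<in> set xs" for j i
  proof (rule cyc_nbrs_eq[OF c sym_theta_edges])
    show "?E `` {Q j (Suc i)} \<subseteq> {Q j i, Q j (Suc (Suc i))}"
      using that(1,2) by (auto elim!: theta_edgesE simp: Q)
  qed fact
  have nb: "Q j i \<in> set xs \<and> Q j (Suc (Suc i)) \<in> set xs"
    if "j < m" "Suc i < n" "Q j (Suc i) \<in> set xs" for j i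
    using inner[OF that] FS by blast
  have down: "Q j i \<in> set xs" if "j < m" "i \<le> l" "l < n" "Q j l \<in> set xs" for i j l
    using that(2,4) by (induction rule: inc_induct) (use that nb in auto)
  have up: "Q j l \<in> set xs" if "j < m" "0 < i" "i \<le> l" "l \<le> n" "Q j i \<in> set xs" for i j l
    using that(3,4,5)
  proof (induction l rule: dec_induct)
    case (step l)
    then show ?case using nb[OF that(1), of "l - 1"] that(2) by simp
  qed
  have whole: "Q j l \<in> set xs" if "j < m" "0 < i" "i < n" "l \<le> n" "Q j i \<in> set xs" for i j l
    using that down[of j l i] up[of j i l] by (cases "l \<le> i") auto
  \<comment> \<open>A path used by the cycle is recognised by its vertex 1. Since \<open>n\<close>
    is at least 2, this vertex is an inner one and belongs to no other path.\<close>
  define J where "J = {j. j < m \<and> Q j 1 \<in> set xs}"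
  have J: "Q j l \<in> set xs" if "j \<in> J" "l \<le> n" for j l
    using that n whole[of j 1 l] by (auto simp: J_def)
  have toJ: "j \<in> J" if "j < m" "0 < i" "i < n" "Q j i \<in> set xs" for j i
    using that n whole[of j i 1] by (auto simp: J_def)
  have "\<exists>j\<in>J. True"
  proof -
    obtain u where u: "u \<in> set xs" using c by (cases xs) (auto simp: cyc_def)
    obtain v where uv: "(u, v) \<in> ?F" using arcs_cyc_through[OF u] by blast
    have "(u, v) \<in> ?E" using uv F by blast
    then obtain j i where ji: "j < m" "i < n" "Q j i \<in> set xs" "Q j (Suc i) \<in> set xs"
      using FS[OF uv] by (auto elim: theta_edgesE)
    \<comment> \<open>As \<open>n\<close> is at least 2, every edge has an end strictly inside its
      path: index 1 if the edge starts at 0, and index \<open>i\<close> otherwise.\<close>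
    then show ?thesis using toJ[of j i] toJ[of j "Suc i"] n by (cases "i = 0") auto
  qed
  then obtain j0 where j0: "j0 \<in> J" by blast
  have Jm: "j < m" if "j \<in> J" for j using that by (simp add: J_def)
  have s: "Q j 0 = Q j0 0" "Q j n = Q j0 n" if "j < m" for j
    using Q[of j j0 0 0] Q[of j j0 n n] that Jm[OF j0] by auto
  have "?F `` {Q j0 0} = (\<lambda>j. Q j 1) ` J"
  proof (intro equalityI subsetI)
    fix v assume v: "v \<in> ?F `` {Q j0 0}"
    then have "(Q j0 0, v) \<in> ?E" using F by blast
    then obtain j where "j < m" "v = Q j 1"
    proof (cases rule: theta_edgesE)
      case (1 j i)
      then have "i = 0" using Q[of j0 j 0 i] Jm[OF j0] by simp
      then show thesis using that 1 by simp
    next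
      case (2 j i)
      then show thesis using Q[of j0 j 0 "Suc i"] Jm[OF j0] by simp
    qed
    moreover have "v \<in> set xs" using v FS by blast
    ultimately show "v \<in> (\<lambda>j. Q j 1) ` J" by (auto simp: J_def)
  next
    fix v assume "v \<in> (\<lambda>j. Q j 1) ` J"
    then obtain j where j: "j \<in> J" "v = Q j 1" by blast
    then have "Q j 0 \<in> ?F `` {v}" using inner[of j 0] n by (auto simp: J_def)
    then show "v \<in> ?F `` {Q j0 0}" using s(1)[OF Jm[OF j(1)]] by auto
  qed
  moreover obtain a b where "a \<noteq> b" "?F `` {Q j0 0} = {a, b}"
    using cyc_nbrs[OF c J[OF j0, of 0]] by auto
  ultimately have "card ((\<lambda>j. Q j 1) ` J) = 2" by (metis card_2_iff)
  moreover have "inj_on (\<lambda>j. Q j 1) J" using n by (auto simp: inj_on_def J_def Q)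
  ultimately have cardJ: "card J = 2" by (simp add: card_image)
  let ?I = "(\<lambda>(j, i). Q j i) ` (J \<times> {0<..<n})"
  have "set xs = {Q j0 0, Q j0 n} \<union> ?I"
  proof (intro equalityI subsetI)
    fix u assume u: "u \<in> set xs"
    then have "u \<in> theta_verts n m Q"
      using cyc_set_in_Field[OF c] theta_edges_subset[of n m Q] by (auto simp: Field_def)
    then obtain j i where ji: "j < m" "i \<le> n" "u = Q j i" by (auto simp: theta_verts_def)
    show "u \<in> {Q j0 0, Q j0 n} \<union> ?I"
    proof (cases "0 < i \<and> i < n")
      case True
      then have "j \<in> J" using toJ ji u by blast
      then show ?thesis using True ji by force
    next
      case False
      then have "i = 0 \<or> i = n" using ji by auto
      then show ?thesis using s ji by auto
    qed
  next
    fix u assume "u \<in> {Q j0 0, Q j0 n} \<union> ?I"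
    then show "u \<in> set xs" using J j0 by auto
  qed
  \<comment> \<open>The count is two common ends and \<open>n - 1\<close> inner vertices on each of
    two paths, hence \<open>2 * n\<close>.\<close>
  moreover have "card ({Q j0 0, Q j0 n} \<union> ?I) = card {Q j0 0, Q j0 n} + card ?I"
  proof (rule card_Un_disjoint)
    show "finite ?I" by (intro finite_imageI finite_cartesian_product) (simp_all add: J_def)
    show "{Q j0 0, Q j0 n} \<inter> ?I = {}" using Jm[OF j0] by (auto simp: J_def Q)
  qed simp
  moreover have "inj_on (\<lambda>(j, i). Q j i) (J \<times> {0<..<n})"
    by (auto simp: inj_on_def J_def Q)
  then have "card ?I = 2 * (n - 1)" by (simp add: card_image card_cartesian_product cardJ)
  moreover have "card {Q j0 0, Q j0 n} = 2" using Q[of j0 j0 0 n] Jm[OF j0] n by auto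
  ultimately have "card (set xs) = 2 + 2 * (n - 1)" by (simp only:)
  then have "card (set xs) = 2 * n" using n by simp
  then show ?thesis using c distinct_card[of xs] by (simp add: cyc_def)
qed

section \<open>The book graph as a theta graph\<close>

text \<open>Path 0 is the spine; path \<open>Suc j\<close> is the other half of cycle \<open>j\<close>, traversed backwards.\<close>

definition book_path :: "nat \<Rightarrow> nat \<Rightarrow> nat \<Rightarrow> nat \<times> nat" where
  "book_path n j i = (if j = 0 \<or> i = 0 \<or> i = n then (0, i) else (j - 1, 2 * n - i))"

lemma theta_book_path: "theta n m (book_path n)"
  unfolding theta_def book_path_def by auto

text \<open>The \<open>mod\<close> takes effect only for \<open>i = 0\<close>, where position
  \<open>2 * n\<close> of a cycle wraps around to its start.\<close>

lemma glue_conv_book_path: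
  "i \<le> n \<Longrightarrow> glue n (j, i) = book_path n 0 i"
  "i \<le> n \<Longrightarrow> 0 < n \<Longrightarrow> glue n (j, (2 * n - i) mod (2 * n)) = book_path n (Suc j) i"
  by (cases "i = 0"; auto simp: glue_def book_path_def)+

lemma verts_book_graph:
  assumes "0 < n" "0 < p"
  shows "pverts (book_graph n (2 * n) p) = theta_verts n (Suc p) (book_path n)"
proof -
  have "glue n (j, i) \<in> theta_verts n (Suc p) (book_path n)" if "j < p" "i < 2 * n" for j i
  proof (cases "i \<le> n")
    case True
    then show ?thesis by (simp add: glue_conv_book_path theta_vertsI)
  next
    case False
    then show ?thesis
      using glue_conv_book_path(2)[of "2 * n - i" n j] that by (simp add: theta_vertsI)
  qed
  moreover have "book_path n j i \<in> glue n ` ({..<p} \<times> {..<2 * n})" if "j < Suc p" "i \<le> n" for j i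
  proof (cases j)
    case 0
    then show ?thesis
      using glue_conv_book_path(1)[of i n 0] assms that by (intro image_eqI[of _ _ "(0, i)"]) auto
  next
    case (Suc k)
    then show ?thesis
      using glue_conv_book_path(2)[of i n k] assms that
      by (intro image_eqI[of _ _ "(k, (2 * n - i) mod (2 * n))"]) auto
  qed
  ultimately show ?thesis
    by (auto simp: book_graph_def Let_def theta_verts_def)
qed

lemma arcs_book_graph:
  assumes "0 < n" "0 < p"
  shows "parcs (book_graph n (2 * n) p) = theta_edges n (Suc p) (book_path n)"
proof -
  define A where "A = {(glue n (j, i), glue n (j, Suc i mod (2 * n))) | j i. j < p \<and> i < 2 * n}"
  have AI: "(glue n (j, i), glue n (j, Suc i mod (2 * n))) \<in> A" if "j < p" "i < 2 * n" for j i
    unfolding A_def using that by blast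
  let ?E = "theta_edges n (Suc p) (book_path n)"
  \<comment> \<open>The positions from \<open>n\<close> to \<open>2 * n - 1\<close> of cycle
    \<open>j\<close> are written as \<open>2 * n - Suc i\<close> with \<open>i < n\<close>: their
    arcs are those of path \<open>Suc j\<close> run backwards.\<close>
  have bk: "(glue n (j, 2 * n - Suc i), glue n (j, Suc (2 * n - Suc i) mod (2 * n))) =
      (book_path n (Suc j) (Suc i), book_path n (Suc j) i)" if "i < n" for j i
  proof -
    have "Suc (2 * n - Suc i) = 2 * n - i" using that by simp
    then show ?thesis
      using that glue_conv_book_path(2)[of "Suc i" n j] glue_conv_book_path(2)[of i n j] by simp
  qed
  have "(glue n (j, i), glue n (j, Suc i mod (2 * n))) \<in> ?E" if "j < p" "i < 2 * n" for j i
  proof (cases "i < n")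
    case True
    then show ?thesis by (simp add: glue_conv_book_path theta_edgesI)
  next
    case False
    then have i: "i = 2 * n - Suc (2 * n - Suc i)" "2 * n - Suc i < n" using that by auto
    show ?thesis
      using bk[OF i(2), of j] that(1) theta_edgesI(2)[of "Suc j" "Suc p" "2 * n - Suc i" n "book_path n"] i
      by simp
  qed
  then have "A \<subseteq> ?E" unfolding A_def by blast
  moreover have "?E\<inverse> = ?E" using sym_theta_edges[of n "Suc p" "book_path n"]
    by (simp add: sym_conv_converse_eq)
  ultimately have sub: "A \<union> A\<inverse> \<subseteq> ?E" by blast
  have "(book_path n j i, book_path n j (Suc i)) \<in> A \<union> A\<inverse>" if "j < Suc p" "i < n" for j i
  proof (cases j)
    case 0
    then show ?thesis using AI[of 0 i] assms that by (simp add: glue_conv_book_path)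
  next
    case (Suc k)
    have "(glue n (k, 2 * n - Suc i), glue n (k, Suc (2 * n - Suc i) mod (2 * n))) \<in> A"
      using Suc that by (intro AI) auto
    then show ?thesis unfolding bk[OF that(2)] Suc by blast
  qed
  note path = this
  have arcs: "theta_arcs n (Suc p) (book_path n) \<subseteq> A \<union> A\<inverse>"
  proof
    fix e assume "e \<in> theta_arcs n (Suc p) (book_path n)"
    then obtain j i where "j < Suc p" "i < n" "e = (book_path n j i, book_path n j (Suc i))"
      by (auto simp: theta_arcs_def)
    then show "e \<in> A \<union> A\<inverse>" using path by simp
  qed
  then have "(theta_arcs n (Suc p) (book_path n))\<inverse> \<subseteq> (A \<union> A\<inverse>)\<inverse>"
    by (rule converse_mono[THEN iffD2])
  also have "(A \<union> A\<inverse>)\<inverse> = A \<union> A\<inverse>"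
    by (simp only: converse_Un converse_converse Un_commute)
  finally have "?E \<subseteq> A \<union> A\<inverse>"
    unfolding theta_edges_def using arcs by (rule Un_least[rotated])
  with sub have "A \<union> A\<inverse> = ?E" by (rule equalityI)
  moreover have "parcs (book_graph n (2 * n) p) = A \<union> A\<inverse>"
    unfolding book_graph_def Let_def A_def by (simp only: pair_pre_digraph.select_convs)
  ultimately show ?thesis by (simp only:)
qed

section \<open>Ears\<close>

lemma rtrancl_on_crossing:
  assumes "(a, b) \<in> rtrancl_on V E" "a \<in> W" "b \<notin> W"
  obtains x z where "(x, z) \<in> E" "x \<in> W" "z \<notin> W" "z \<in> V"
proof -
  have "b \<notin> W \<longrightarrow> (\<exists>x z. (x, z) \<in> E \<and> x \<in> W \<and> z \<notin> W \<and> z \<in> V)"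
    using assms(1)
  proof (induct rule: rtrancl_on_induct)
    case (step y z)
    then show ?case by (cases "y \<in> W") blast+
  qed (use assms(2) in blast)
  then show thesis using that assms(3) by blast
qed

text \<open>If \<open>W\<close> is not all of \<open>V\<close>, some arc leaves \<open>W\<close> at
  a vertex \<open>x\<close>. Deleting \<open>x\<close> keeps the outside end connected to another
  vertex of \<open>W\<close>, and the ear stops at the first return to \<open>W\<close>. If
  \<open>W\<close> is all of \<open>V\<close>, an arc outside \<open>F\<close> is an ear without
  inner vertices.\<close>

lemma ear_exists:
  assumes bc: "biconn V E" and irr: "\<And>u v. (u, v) \<in> E \<Longrightarrow> u \<noteq> v" and EV: "E \<subseteq> V \<times> V"
    and W: "W \<subseteq> V" "a \<in> W" "b \<in> W" "a \<noteq> b" and F: "F \<subseteq> E" and ne: "V = W \<Longrightarrow> E \<noteq> F"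
  obtains x p y where "x \<in> W" "y \<in> W" "walk E (x # p @ [y])" "distinct (x # p @ [y])"
    "set p \<inter> W = {}" "p = [] \<Longrightarrow> (x, y) \<notin> F"
proof (cases "V = W")
  case True
  then obtain x y where "(x, y) \<in> E" "(x, y) \<notin> F" using ne F by auto
  moreover have "x \<noteq> y" "x \<in> W" "y \<in> W" using irr EV True \<open>(x, y) \<in> E\<close> by auto
  ultimately show thesis using that[of x y "[]"] by simp
next
  case False
  then obtain z0 where "z0 \<in> V" "z0 \<notin> W" using W by blast
  moreover have "(a, z0) \<in> rtrancl_on V E"
    using bc W \<open>z0 \<in> V\<close> by (auto simp: biconn_def conn_on_def)
  ultimately obtain x z where xz: "(x, z) \<in> E" "x \<in> W" "z \<notin> W" "z \<in> V"
    using rtrancl_on_crossing[of a z0 V E W] W by blast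
  obtain w where w: "w \<in> W" "w \<noteq> x" using W by blast
  have "(z, w) \<in> rtrancl_on (V - {x}) E"
    using biconn_conn_on[OF bc, of x] xz w W by (auto simp: conn_on_def)
  then obtain zs where zs: "zs \<noteq> []" "distinct zs" "walk E zs" "set zs \<subseteq> V - {x}" "hd zs = z" "last zs = w"
    by (rule rtrancl_on_walk)
  have "\<exists>u\<in>set zs. u \<in> W" using zs(1,6) w by (metis last_in_set)
  then obtain p y rest where p: "zs = p @ y # rest" "y \<in> W" "\<forall>u\<in>set p. u \<notin> W"
    by (rule split_list_first_propE)
  have "p \<noteq> []" using p xz(3) zs(5) by auto
  then have "walk E (x # p @ [y])"
    using zs(3,5) xz(1) unfolding p(1) by (auto simp: successively_Cons successively_append_iff)
  moreover have "distinct (x # p @ [y])" using zs(2,4) unfolding p(1) by auto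
  ultimately show thesis using that[of x y p] xz(2) p(2,3) \<open>p \<noteq> []\<close> by blast
qed

text \<open>\<open>p\<close> may be empty, in which case an edge closes \<open>zs\<close> directly;
  the last bound then excludes running along one edge back and forth.\<close>

lemma cyc_close:
  assumes "sym E" "walk E zs" "distinct zs" "2 \<le> length zs"
    and "walk E (hd zs # p @ [last zs])" "distinct p" "set p \<inter> set zs = {}" "3 \<le> length zs + length p"
  shows "cyc E (zs @ rev p)"
proof -
  have "zs \<noteq> []" using assms(4) by auto
  have "walk E (last zs # rev p @ [hd zs])"
    using walk_sym_rev[OF assms(1,5)] by simp
  then have "walk E (rev p)" "p \<noteq> [] \<Longrightarrow> (last zs, last p) \<in> E" "(last (last zs # rev p), hd zs) \<in> E"
    by (auto simp: successively_Cons successively_append_iff hd_append hd_rev last_rev split: if_splits)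
  then show ?thesis
    using assms \<open>zs \<noteq> []\<close>
    by (auto simp: cyc_iff_walk successively_append_iff hd_rev last_rev split: if_splits)
qed

section \<open>Paths in theta graphs\<close>

text \<open>Staying inside \<open>W\<close> makes such a path disjoint from the interior of an ear,
  which avoids \<open>W\<close>.\<close>

definition fpath :: "'a rel \<Rightarrow> 'a set \<Rightarrow> 'a \<Rightarrow> 'a \<Rightarrow> 'a list \<Rightarrow> bool" where
  "fpath F W x y zs \<longleftrightarrow> zs \<noteq> [] \<and> distinct zs \<and> walk F zs \<and> set zs \<subseteq> W \<and> hd zs = x \<and> last zs = y"

lemma fpath_rev: "sym F \<Longrightarrow> fpath F W x y zs \<Longrightarrow> fpath F W y x (rev zs)"
  by (simp add: fpath_def hd_rev last_rev walk_sym_rev del: successively_rev)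

lemma fpath_append:
  assumes "fpath F W x y zs" "fpath F W x' y' zs'" "(y, x') \<in> F" "set zs \<inter> set zs' = {}"
  shows "fpath F W x y' (zs @ zs')"
  using assms by (simp add: fpath_def successively_append_iff)

lemma fpath_theta_seg:
  assumes "theta n m Q" "j < m" "i \<le> l" "l \<le> n"
  shows "fpath (theta_edges n m Q) (theta_verts n m Q) (Q j i) (Q j l) (map (Q j) [i..<Suc l])"
proof -
  have "walk (theta_edges n m Q) (map (Q j) [i..<Suc l])"
    using assms by (auto simp: successively_conv_nth intro: theta_edgesI simp del: upt_Suc)
  moreover have "inj_on (Q j) {i..<Suc l}"
    using assms by (auto simp: inj_on_def thetaD[OF assms(1)])
  ultimately show ?thesis
    using assms by (auto simp: fpath_def distinct_map hd_map last_map intro: theta_vertsI simp del: upt_Suc)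
qed

lemma fpath_theta_rev_seg:
  assumes "theta n m Q" "j < m" "i \<le> l" "l \<le> n"
  shows "fpath (theta_edges n m Q) (theta_verts n m Q) (Q j l) (Q j i) (map (Q j) (rev [i..<Suc l]))"
  using fpath_rev[OF sym_theta_edges fpath_theta_seg[OF assms]] by (simp only: rev_map)

text \<open>The route descends path \<open>j\<close> to the common end and climbs path
  \<open>k\<close>, whose list starts at index 1 because that end is already present. It has
  \<open>i + l\<close> edges.\<close>

lemma fpath_theta_across:
  assumes th: "theta n m Q" and lt: "j < m" "k < m" "j \<noteq> k" and il: "i < n" "0 < l" "l < n"
  shows "fpath (theta_edges n m Q) (theta_verts n m Q) (Q j i) (Q k l)
    (map (Q j) (rev [0..<Suc i]) @ map (Q k) [1..<Suc l])"
proof (rule fpath_append)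
  show "fpath (theta_edges n m Q) (theta_verts n m Q) (Q j i) (Q j 0) (map (Q j) (rev [0..<Suc i]))"
    using il by (intro fpath_theta_rev_seg[OF th lt(1)]) auto
  show "fpath (theta_edges n m Q) (theta_verts n m Q) (Q k 1) (Q k l) (map (Q k) [1..<Suc l])"
    using il by (intro fpath_theta_seg[OF th lt(2)]) auto
  show "(Q j 0, Q k 1) \<in> theta_edges n m Q"
    using theta_edgesI(1)[of k m 0 n Q] lt il thetaD[OF th lt(1,2), of 0 0] by simp
  show "set (map (Q j) (rev [0..<Suc i])) \<inter> set (map (Q k) [1..<Suc l]) = {}"
    using lt il by (auto simp: thetaD[OF th] simp del: upt_Suc)
qed

text \<open>The route descends path \<open>j\<close> to index 0, follows the interior of path
  \<open>h\<close>, and descends path \<open>k\<close> from index \<open>n\<close> to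
  \<open>l\<close>. It has \<open>i + n + (n - l)\<close> edges. If \<open>j = k\<close>, the
  condition \<open>i < l\<close> keeps the two outer pieces apart.\<close>

lemma fpath_theta_detour:
  assumes th: "theta n m Q" and n: "2 \<le> n" and lt: "j < m" "k < m" "h < m" "h \<noteq> j" "h \<noteq> k"
    and il: "i < n" "0 < l" "l \<le> n" "j = k \<Longrightarrow> i < l"
  shows "fpath (theta_edges n m Q) (theta_verts n m Q) (Q j i) (Q k l)
    ((map (Q j) (rev [0..<Suc i]) @ map (Q h) [1..<Suc (n - 1)]) @ map (Q k) (rev [l..<Suc n]))"
proof (rule fpath_append)
  show "fpath (theta_edges n m Q) (theta_verts n m Q) (Q j i) (Q h (n - 1))
      (map (Q j) (rev [0..<Suc i]) @ map (Q h) [1..<Suc (n - 1)])"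
    using n lt il(1) by (intro fpath_theta_across[OF th]) auto
  show "fpath (theta_edges n m Q) (theta_verts n m Q) (Q k n) (Q k l) (map (Q k) (rev [l..<Suc n]))"
    using il by (intro fpath_theta_rev_seg[OF th lt(2)]) auto
  show "(Q h (n - 1), Q k n) \<in> theta_edges n m Q"
    using theta_edgesI(1)[of h m "n - 1" n Q] lt n thetaD[OF th lt(2,3), of n n] by simp
  show "set (map (Q j) (rev [0..<Suc i]) @ map (Q h) [1..<Suc (n - 1)]) \<inter> set (map (Q k) (rev [l..<Suc n])) = {}"
    using lt il n by (auto simp: thetaD[OF th] simp del: upt_Suc)
qed

text \<open>The direct segment has \<open>l - i\<close> edges and the detour over another path has
  \<open>i + n + (n - l)\<close>. Equality forces \<open>l - i = n\<close>.\<close>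

lemma theta_same_path_ends:
  assumes th: "theta n m Q" and n: "2 \<le> n" and m: "2 \<le> m" and il: "j < m" "i < l" "l \<le> n"
    and eq: "\<And>zs zs'. fpath (theta_edges n m Q) (theta_verts n m Q) (Q j i) (Q j l) zs \<Longrightarrow>
      fpath (theta_edges n m Q) (theta_verts n m Q) (Q j i) (Q j l) zs' \<Longrightarrow> length zs = length zs'"
  shows "i = 0 \<and> l = n"
proof -
  define h where "h = (if j = 0 then 1 else 0 :: nat)"
  have h: "h < m" "h \<noteq> j" using m by (auto simp: h_def)
  from eq[OF fpath_theta_seg[OF th il(1) less_imp_le[OF il(2)] il(3)]
      fpath_theta_detour[OF th _ il(1) il(1) h h(2)]]
  show ?thesis using il n by auto
qed

text \<open>For inner vertices of different paths, going through index 0 takes \<open>i + l\<close>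
  edges and the detour over a third path takes \<open>i + n + (n - l)\<close>. Equality would give
  \<open>l = n\<close>, which is not an inner index.\<close>

lemma theta_equal_paths_ends:
  assumes th: "theta n m Q" and n: "2 \<le> n" and m: "3 \<le> m"
    and xy: "x \<in> theta_verts n m Q" "y \<in> theta_verts n m Q" "x \<noteq> y"
    and eq: "\<And>zs zs'. fpath (theta_edges n m Q) (theta_verts n m Q) x y zs \<Longrightarrow>
      fpath (theta_edges n m Q) (theta_verts n m Q) x y zs' \<Longrightarrow> length zs = length zs'"
  shows "(x = Q 0 0 \<and> y = Q 0 n) \<or> (x = Q 0 n \<and> y = Q 0 0)"
proof -
  note Q = thetaD[OF th]
  have m2: "2 \<le> m" using m by simp
  have same: ?thesis if j: "j < m" "i \<le> n" "l \<le> n" "x = Q j i" "y = Q j l" for j i l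
  proof (cases "i < l")
    case True
    have "i = 0 \<and> l = n"
      by (rule theta_same_path_ends[OF th n m2 j(1) True j(3) eq[unfolded j(4,5)]])
    then show ?thesis using j Q[of j 0 0 0] Q[of j 0 n n] by simp
  next
    case False
    then have "l < i" using xy(3) j by (cases "i = l") auto
    have "l = 0 \<and> i = n"
    proof (rule theta_same_path_ends[OF th n m2 j(1) \<open>l < i\<close> j(2)])
      fix zs zs'
      assume "fpath (theta_edges n m Q) (theta_verts n m Q) (Q j l) (Q j i) zs"
        "fpath (theta_edges n m Q) (theta_verts n m Q) (Q j l) (Q j i) zs'"
      then have "fpath (theta_edges n m Q) (theta_verts n m Q) x y (rev zs)"
        "fpath (theta_edges n m Q) (theta_verts n m Q) x y (rev zs')"
        using fpath_rev[OF sym_theta_edges] j(4,5) by simp_all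
      from eq[OF this] show "length zs = length zs'" by simp
    qed
    then show ?thesis using j Q[of j 0 0 0] Q[of j 0 n n] by simp
  qed
  obtain j i where j: "j < m" "i \<le> n" "x = Q j i" using xy(1) by (auto simp: theta_verts_def)
  obtain k l where k: "k < m" "l \<le> n" "y = Q k l" using xy(2) by (auto simp: theta_verts_def)
  \<comment> \<open>The ends belong to every path, so a pair containing an end can be placed on a
    single path.\<close>
  consider "j = k" | "i = 0 \<or> i = n" | "l = 0 \<or> l = n" | "j \<noteq> k" "0 < i" "i < n" "0 < l" "l < n"
    using j(2) k(2) by (meson gr0I le_neq_implies_less)
  then show ?thesis
  proof cases
    case 1
    then show ?thesis using same[of j i l] j k by simp
  next
    case 2
    then have "x = Q k i" using j k Q[of j k i i] by simp
    then show ?thesis using same[of k i l] j k by simp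
  next
    case 3
    then have "y = Q j l" using j k Q[of k j l l] by simp
    then show ?thesis using same[of j i l] j k by simp
  next
    case 4
    obtain h where h: "h < m" "h \<noteq> j" "h \<noteq> k"
    proof -
      have "(0 \<noteq> j \<and> 0 \<noteq> k) \<or> (1 \<noteq> j \<and> 1 \<noteq> k) \<or> (2 \<noteq> j \<and> 2 \<noteq> k)" by auto
      moreover have "0 < m" "1 < m" "2 < m" using m by auto
      ultimately show thesis using that by metis
    qed
    from eq[unfolded j(3) k(3), OF fpath_theta_across[OF th j(1) k(1) 4(1) 4(3-5)]
        fpath_theta_detour[OF th _ j(1) k(1) h]]
    have False using 4 by simp
    then show ?thesis ..
  qed
qed

section \<open>Growing a theta graph\<close>

definition theta_add :: "nat \<Rightarrow> nat \<Rightarrow> (nat \<Rightarrow> nat \<Rightarrow> 'a) \<Rightarrow> 'a list \<Rightarrow> nat \<Rightarrow> nat \<Rightarrow> 'a" where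
  "theta_add n m Q p = Q(m := (!) (Q 0 0 # p @ [Q 0 n]))"

lemma theta_single:
  assumes "distinct (x # a @ [y])" "n = Suc (length a)"
  shows "theta n 1 (\<lambda>j. (!) (x # a @ [y]))"
  using assms nth_eq_iff_index_eq[OF assms(1)] by (auto simp: theta_def)

lemma theta_add:
  assumes th: "theta n m Q" and m: "0 < m" and p: "distinct p" "Suc (length p) = n"
    "set p \<inter> theta_verts n m Q = {}"
  shows "theta n (Suc m) (theta_add n m Q p)"
proof -
  let ?L = "Q 0 0 # p @ [Q 0 n]"
  note Q = thetaD[OF th]
  have n: "0 < n" using p by auto
  have Q0: "Q 0 0 \<in> theta_verts n m Q" "Q 0 n \<in> theta_verts n m Q" using m by (auto intro: theta_vertsI)
  have "Q 0 0 \<noteq> Q 0 n" using Q[of 0 0 0 n] m n by simp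
  then have dist: "distinct ?L" using p Q0 by auto
  have new: "?L ! i = Q k l \<longleftrightarrow> i = l \<and> (i = 0 \<or> i = n)" if k: "k < m" "i \<le> n" "l \<le> n" for i k l
  proof -
    consider "i = 0" | "i = n" | "0 < i" "i < n" using k(2) by linarith
    then show ?thesis
    proof cases
      case 1
      then show ?thesis using Q[of 0 k 0 l] k m by auto
    next
      case 2
      then have "?L ! i = Q 0 n" using p(2) by (auto simp: nth_append)
      then show ?thesis using Q[of 0 k n l] k m n 2 by auto
    next
      case 3
      then have "?L ! i \<in> set p" using p(2) by (auto simp: nth_append nth_Cons')
      then have "?L ! i \<noteq> Q k l" using p(3) theta_vertsI[of k m l n Q] k by auto
      then show ?thesis using 3 by simp
    qed
  qed
  have self: "?L ! i = ?L ! l \<longleftrightarrow> i = l" if "i \<le> n" "l \<le> n" for i l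
    using nth_eq_iff_index_eq[OF dist, of i l] that p(2) by simp
  show ?thesis unfolding theta_def
  proof (intro allI impI)
    fix j k i l assume "j < Suc m" "k < Suc m" "i \<le> n" "l \<le> n"
    then consider "j < m" "k < m" | "j = m" "k < m" | "j < m" "k = m" | "j = m" "k = m" by linarith
    then show "theta_add n m Q p j i = theta_add n m Q p k l \<longleftrightarrow> i = l \<and> (j = k \<or> i = 0 \<or> i = n)"
    proof cases
      case 1
      then show ?thesis using Q[OF 1 \<open>i \<le> n\<close> \<open>l \<le> n\<close>] by (simp add: theta_add_def)
    next
      case 2
      then show ?thesis using new[of k i l] \<open>i \<le> n\<close> \<open>l \<le> n\<close> by (simp add: theta_add_def)
    next
      case 3
      then show ?thesis using new[of j l i] \<open>i \<le> n\<close> \<open>l \<le> n\<close> by (auto simp: theta_add_def)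
    next
      case 4
      then show ?thesis using self \<open>i \<le> n\<close> \<open>l \<le> n\<close> by (simp add: theta_add_def)
    qed
  qed
qed

lemma theta_edges_subsetI:
  assumes "sym E" "\<And>j i. j < m \<Longrightarrow> i < n \<Longrightarrow> (Q j i, Q j (Suc i)) \<in> E"
  shows "theta_edges n m Q \<subseteq> E"
proof (rule subrelI, erule theta_edgesE)
  fix u v j i
  assume ji: "j < m" "i < n"
  note e = assms(2)[OF ji]
  show "u = Q j i \<Longrightarrow> v = Q j (Suc i) \<Longrightarrow> (u, v) \<in> E" using e by simp
  show "v = Q j i \<Longrightarrow> u = Q j (Suc i) \<Longrightarrow> (u, v) \<in> E" using symD[OF assms(1) e] by simp
qed

lemma theta_single_edges:
  assumes "walk E (x # a @ [y])" "sym E" "n = Suc (length a)"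
  shows "theta_edges n 1 (\<lambda>j. (!) (x # a @ [y])) \<subseteq> E"
    "theta_verts n 1 (\<lambda>j. (!) (x # a @ [y])) = set (x # a @ [y])"
proof -
  have "((x # a @ [y]) ! i, (x # a @ [y]) ! Suc i) \<in> E" if "i < n" for i
    using successively_nth[OF assms(1), of i] that assms(3) by simp
  then show "theta_edges n 1 (\<lambda>j. (!) (x # a @ [y])) \<subseteq> E"
    by (rule theta_edges_subsetI[OF assms(2)])
  show "theta_verts n 1 (\<lambda>j. (!) (x # a @ [y])) = set (x # a @ [y])"
    unfolding set_conv_nth theta_verts_def using assms(3) by (auto simp del: nth_Cons_Suc simp: less_Suc_eq_le)
qed

lemma theta_add_edges:
  assumes "theta_edges n m Q \<subseteq> E" "walk E (Q 0 0 # p @ [Q 0 n])" "sym E" "n = Suc (length p)"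
  shows "theta_edges n (Suc m) (theta_add n m Q p) \<subseteq> E"
proof -
  have "((Q 0 0 # p @ [Q 0 n]) ! i, (Q 0 0 # p @ [Q 0 n]) ! Suc i) \<in> E" if "i < n" for i
    using successively_nth[OF assms(2), of i] that assms(4) by simp
  then have "(theta_add n m Q p j i, theta_add n m Q p j (Suc i)) \<in> E" if "j < Suc m" "i < n" for j i
    using that theta_edgesI(1)[of j m i n Q] assms(1)
    by (cases "j = m") (auto simp: theta_add_def simp del: nth_Cons_Suc)
  then show ?thesis by (rule theta_edges_subsetI[OF assms(3)])
qed

lemma theta_add_verts:
  assumes "n = Suc (length p)" "0 < m"
  shows "theta_verts n (Suc m) (theta_add n m Q p) = theta_verts n m Q \<union> set p"
proof -
  let ?L = "Q 0 0 # p @ [Q 0 n]"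
  have "theta_verts n (Suc m) (theta_add n m Q p) = theta_verts n m Q \<union> (!) ?L ` {..n}"
    unfolding theta_verts_def theta_add_def by (force simp: less_Suc_eq)
  also have "(!) ?L ` {..n} = set ?L"
    using assms(1) by (auto simp: set_conv_nth less_Suc_eq_le simp del: nth_Cons_Suc)
  finally show ?thesis using assms(2) theta_vertsI[of 0 m 0 n Q] theta_vertsI[of 0 m n n Q] by auto
qed

lemma theta_grow:
  assumes th: "theta n m Q" and n: "2 \<le> n" and m: "3 \<le> m" and sub: "theta_edges n m Q \<subseteq> E"
    and sym: "sym E" and len: "\<And>xs. cyc E xs \<Longrightarrow> length xs = 2 * n"
    and ear: "x \<in> theta_verts n m Q" "y \<in> theta_verts n m Q" "walk E (x # p @ [y])"
      "distinct (x # p @ [y])" "set p \<inter> theta_verts n m Q = {}" "p = [] \<Longrightarrow> (x, y) \<notin> theta_edges n m Q"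
  obtains R where "theta n (Suc m) R" "theta_edges n (Suc m) R \<subseteq> E"
proof -
  let ?F = "theta_edges n m Q" and ?W = "theta_verts n m Q"
  have xy: "x \<noteq> y" using ear(4) by auto
  have total: "length zs + length p = 2 * n" if zs: "fpath ?F ?W x y zs" for zs
  proof -
    obtain u us where u: "zs = u # us" using zs by (cases zs) (auto simp: fpath_def)
    have us: "us \<noteq> []" using zs xy unfolding u by (auto simp: fpath_def)
    have "us = [y] \<Longrightarrow> (x, y) \<in> ?F" using zs unfolding u by (auto simp: fpath_def)
    \<comment> \<open>An ear without inner vertices is an edge outside the theta graph, so the path
      \<open>zs\<close> it closes cannot be a single edge.\<close>
    then have "p = [] \<Longrightarrow> 2 \<le> length us"
      using ear(6) zs us unfolding u by (cases us; cases "tl us") (auto simp: fpath_def)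
    then have "3 \<le> length zs + length p" using us unfolding u by (cases p; cases us) auto
    moreover have "2 \<le> length zs" using us unfolding u by (cases us) auto
    moreover have "walk E zs" "distinct zs" "set p \<inter> set zs = {}" "hd zs = x" "last zs = y"
      using zs ear(5) walk_mono[OF _ sub] by (auto simp: fpath_def)
    ultimately have "cyc E (zs @ rev p)"
      using ear(3,4) by (intro cyc_close[OF sym]) auto
    from len[OF this] show ?thesis by simp
  qed
  have "length zs = length zs'" if "fpath ?F ?W x y zs" "fpath ?F ?W x y zs'" for zs zs'
    using total[OF that(1)] total[OF that(2)] by simp
  then have ends: "(x = Q 0 0 \<and> y = Q 0 n) \<or> (x = Q 0 n \<and> y = Q 0 0)"
    by (rule theta_equal_paths_ends[OF th n m ear(1,2) xy])
  have m0: "0 < m" using m by simp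
  have seg: "fpath ?F ?W (Q 0 0) (Q 0 n) (map (Q 0) [0..<Suc n])"
    by (rule fpath_theta_seg[OF th m0]) auto
  obtain q where q: "walk E (Q 0 0 # q @ [Q 0 n])" "distinct q" "set q = set p" "length q = length p"
    using ends
  proof
    assume "x = Q 0 0 \<and> y = Q 0 n"
    then show thesis using that[of p] ear(3,4) by simp
  next
    assume xy: "x = Q 0 n \<and> y = Q 0 0"
    then have "walk E (Q 0 0 # rev p @ [Q 0 n])" using walk_sym_rev[OF sym ear(3)] by simp
    then show thesis using that[of "rev p"] ear(4) by simp
  qed
  \<comment> \<open>Path 0 has \<open>n + 1\<close> vertices, so \<open>total\<close> leaves
    \<open>n - 1\<close> inner vertices for the ear. The second case only reverses the
    direction.\<close>
  have "Suc (length p) = n"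
    using ends
  proof
    assume "x = Q 0 0 \<and> y = Q 0 n"
    then show ?thesis using total[of "map (Q 0) [0..<Suc n]"] seg by simp
  next
    assume "x = Q 0 n \<and> y = Q 0 0"
    then show ?thesis using total[of "rev (map (Q 0) [0..<Suc n])"] fpath_rev[OF sym_theta_edges seg] by simp
  qed
  then have "theta n (Suc m) (theta_add n m Q q)" "theta_edges n (Suc m) (theta_add n m Q q) \<subseteq> E"
    using q ear(5) by (intro theta_add[OF th m0] theta_add_edges[OF sub q(1) sym]; simp)+
  then show thesis by (rule that)
qed

text \<open>The vertices with index 1 on the \<open>m\<close> paths are distinct. The bound
  guarantees that a largest theta graph exists.\<close>

lemma theta_paths_bound:
  assumes "theta n m Q" "2 \<le> n" "theta_edges n m Q \<subseteq> V \<times> V" "finite V"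
  shows "m \<le> card V"
proof -
  have "inj_on (\<lambda>j. Q j 1) {..<m}" using assms(2) by (auto simp: inj_on_def thetaD[OF assms(1)])
  moreover have "(\<lambda>j. Q j 1) ` {..<m} \<subseteq> V"
  proof
    fix v assume "v \<in> (\<lambda>j. Q j 1) ` {..<m}"
    then obtain j where "j < m" "v = Q j 1" by blast
    then have "(Q j 0, v) \<in> theta_edges n m Q" using theta_edgesI(1)[of j m 0 n Q] assms(2) by simp
    then show "v \<in> V" using assms(3) by blast
  qed
  ultimately show ?thesis using card_mono[OF assms(4)] by (metis card_image card_lessThan)
qed

text \<open>The ends of the ear split the cycle into paths with interiors \<open>a\<close> and
  \<open>b\<close>. The three cycles formed with \<open>p\<close> give
  \<open>a + b + 2 = a + p + 2 = b + p + 2 = r\<close> for the lengths, so all three are equal to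
  \<open>n - 1\<close> and \<open>r = 2 * n\<close>.\<close>

lemma theta_of_cyc_ear:
  assumes sym: "sym E" and len: "\<And>xs. cyc E xs \<Longrightarrow> length xs = r" and c: "cyc E xs"
    and ear: "x \<in> set xs" "y \<in> set xs" "walk E (x # p @ [y])" "distinct (x # p @ [y])"
      "set p \<inter> set xs = {}" "p = [] \<Longrightarrow> (x, y) \<notin> arcs_cyc xs \<union> (arcs_cyc xs)\<inverse>"
  obtains n Q where "2 \<le> n" "r = 2 * n" "theta n 3 Q" "theta_edges n 3 Q \<subseteq> E"
proof -
  obtain k c where k: "rotate k xs = x # c" using ear(1) by (rule obtain_rotate)
  have set: "set xs = set (x # c)" by (metis k set_rotate)
  then have "y \<in> set c" using ear(2,4) by auto
  then obtain a b where c_eq: "c = a @ y # b" by (meson split_list)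
  have cy: "cyc E (x # a @ y # b)" using cyc_rotate[OF c, of k] k c_eq by simp
  have arcs: "arcs_cyc xs = arcs_cyc (x # a @ y # b)" using arcs_cyc_rotate[of k xs] k c_eq by simp
  have dist: "distinct (x # a @ y # b)" and w: "walk E (x # a @ y # b)" and l: "(last (y # b), x) \<in> E"
    using cy by (auto simp: cyc_iff_walk)
  have wa: "walk E (x # a @ [y])"
    using w successively_append_iff[of _ "x # a @ [y]" b] by simp
  have "walk E (y # b)" using w successively_append_iff[of _ "x # a" "y # b"] by simp
  then have "walk E (y # b @ [x])" using l successively_append_iff[of _ "y # b" "[x]"] by simp
  then have wb: "walk E (x # rev b @ [y])" using walk_sym_rev[OF sym, of "y # b @ [x]"] by simp
  \<comment> \<open>An ear without inner vertices is a chord, so its ends are not adjacent on the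
    cycle. This makes the three closures genuine cycles and gives \<open>n >= 2\<close>.\<close>
  have "a \<noteq> []" if "p = []"
  proof
    assume "a = []"
    then have "(x, y) \<in> arcs_cyc xs" unfolding arcs by simp
    then show False using ear(6) that by blast
  qed
  moreover have "b \<noteq> []" if "p = []"
  proof
    assume "b = []"
    then have "(y, x) \<in> arcs_cyc xs" unfolding arcs by (subst arcs_cyc_conv) auto
    then show False using ear(6) that by blast
  qed
  ultimately have ne: "1 \<le> length a + length p" "1 \<le> length b + length p"
    by (cases a; cases b; cases p; simp)+
  have dp: "distinct p" "set p \<inter> set (x # a @ y # b) = {}" using ear(4,5) set c_eq by auto
  have "cyc E ((x # a @ [y]) @ rev p)"
    using dist dp wa ear(3) ne by (intro cyc_close[OF sym]) auto
  from len[OF this] have la: "length a + length p + 2 = r" by simp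
  have "cyc E ((x # rev b @ [y]) @ rev p)"
    using dist dp wb ear(3) ne by (intro cyc_close[OF sym]) auto
  from len[OF this] have lb: "length b + length p + 2 = r" by simp
  have lab: "length a + length b + 2 = r" using len[OF cy] by simp
  define n where "n = Suc (length a)"
  have n: "2 \<le> n" "r = 2 * n" "n = Suc (length (rev b))" "n = Suc (length p)"
    using la lb lab ne unfolding n_def by auto
  define Q1 where "Q1 = (\<lambda>j::nat. (!) (x # a @ [y]))"
  define Q2 where "Q2 = theta_add n 1 Q1 (rev b)"
  define Q3 where "Q3 = theta_add n 2 Q2 p"
  have Q1: "theta n 1 Q1" "theta_edges n 1 Q1 \<subseteq> E" "theta_verts n 1 Q1 = set (x # a @ [y])"
    unfolding Q1_def
    using theta_single[of x a y n] theta_single_edges[OF wa sym n_def] dist n_def by auto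
  have e1: "Q1 0 0 = x" "Q1 0 n = y" by (auto simp: Q1_def n_def nth_append)
  have Q2: "theta n 2 Q2" "theta_edges n 2 Q2 \<subseteq> E" "theta_verts n 2 Q2 = set (x # a @ [y]) \<union> set b"
    unfolding Q2_def
    using theta_add[OF Q1(1), of "rev b"] theta_add_edges[OF Q1(2) _ sym n(3)]
      theta_add_verts[OF n(3), of 1 Q1] Q1(3) dist wb n(3) e1
    by (auto simp: numeral_2_eq_2)
  have e2: "Q2 0 0 = x" "Q2 0 n = y" using e1 by (simp_all add: Q2_def theta_add_def)
  have "theta n 3 Q3" "theta_edges n 3 Q3 \<subseteq> E"
    unfolding Q3_def
    using theta_add[OF Q2(1), of p] theta_add_edges[OF Q2(2) _ sym n(4)] Q2(3) dp ear(3) n(4) e2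
    by (auto simp: numeral_3_eq_3 numeral_2_eq_2)
  then show thesis using that n(1,2) by blast
qed

lemma biconn_equal_cycles_structure:
  assumes bc: "biconn V E" and sym: "sym E" and irr: "\<And>u v. (u, v) \<in> E \<Longrightarrow> u \<noteq> v"
    and EV: "E \<subseteq> V \<times> V" and fin: "finite V"
    and len: "\<And>xs. cyc E xs \<Longrightarrow> length xs = r" and c: "cyc E xs"
  obtains "V = set xs" "E = arcs_cyc xs \<union> (arcs_cyc xs)\<inverse>"
    | n m Q where "2 \<le> n" "3 \<le> m" "r = 2 * n" "theta n m Q" "V = theta_verts n m Q" "E = theta_edges n m Q"
proof (cases "V = set xs \<and> E = arcs_cyc xs \<union> (arcs_cyc xs)\<inverse>")
  case True
  then show thesis using that(1) by blast
next
  case False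
  let ?C = "arcs_cyc xs \<union> (arcs_cyc xs)\<inverse>"
  have W: "set xs \<subseteq> V" using cyc_set_in_Field[OF c] EV by (auto simp: Field_def)
  have F: "?C \<subseteq> E" using c sym unfolding cyc_def by (blast dest: symD)
  obtain a b where ab: "a \<in> set xs" "b \<in> set xs" "a \<noteq> b"
    using c by (cases xs; cases "tl xs") (auto simp: cyc_def)
  obtain x p y where ear: "x \<in> set xs" "y \<in> set xs" "walk E (x # p @ [y])" "distinct (x # p @ [y])"
    "set p \<inter> set xs = {}" "p = [] \<Longrightarrow> (x, y) \<notin> ?C"
    by (rule ear_exists[OF bc irr EV W ab F]) (use False in auto)
  obtain n Q where n: "2 \<le> n" "r = 2 * n" and Q3: "theta n 3 Q" "theta_edges n 3 Q \<subseteq> E"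
    by (rule theta_of_cyc_ear[OF sym len c ear])
  let ?P = "\<lambda>m. 3 \<le> m \<and> (\<exists>Q. theta n m Q \<and> theta_edges n m Q \<subseteq> E)"
  have "m < Suc (card V)" if Pm: "?P m" for m
  proof -
    obtain Q where "theta n m Q" "theta_edges n m Q \<subseteq> E" using Pm by blast
    then have "m \<le> card V" using theta_paths_bound[OF _ n(1) _ fin] EV by (meson subset_trans)
    then show ?thesis by simp
  qed
  moreover have "?P 3" using Q3 by blast
  ultimately obtain m where m: "?P m" "\<And>l. ?P l \<Longrightarrow> l \<le> m"
    using ex_has_greatest_nat[of ?P 3 "\<lambda>m. m" "Suc (card V)"] by blast
  then obtain Q where Q: "theta n m Q" "theta_edges n m Q \<subseteq> E" and m3: "3 \<le> m" by blast
  let ?W = "theta_verts n m Q" and ?F = "theta_edges n m Q"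
  have W: "?W \<subseteq> V"
  proof
    fix v assume "v \<in> ?W"
    then obtain j i where ji: "j < m" "i \<le> n" "v = Q j i" by (auto simp: theta_verts_def)
    have "\<exists>w. (v, w) \<in> ?F"
    proof (cases i)
      case 0
      then show ?thesis using theta_edgesI(1)[of j m 0 n Q] ji n(1) by auto
    next
      case (Suc l)
      then show ?thesis using theta_edgesI(2)[of j m l n Q] ji by auto
    qed
    then show "v \<in> V" using Q(2) EV by blast
  qed
  have m0: "0 < m" using m3 by simp
  have ends: "Q 0 0 \<in> ?W" "Q 0 n \<in> ?W" "Q 0 0 \<noteq> Q 0 n"
    using theta_vertsI[OF m0, of 0 n Q] theta_vertsI[OF m0, of n n Q] thetaD[OF Q(1) m0 m0, of 0 n] n(1)
    by auto
  show thesis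
  proof (cases "V = ?W \<and> E = ?F")
    case True
    then show thesis using that(2) n m3 Q(1) by blast
  next
    case False
    obtain x p y where ear: "x \<in> ?W" "y \<in> ?W" "walk E (x # p @ [y])" "distinct (x # p @ [y])"
      "set p \<inter> ?W = {}" "p = [] \<Longrightarrow> (x, y) \<notin> ?F"
      by (rule ear_exists[OF bc irr EV W ends Q(2)]) (use False in auto)
    obtain R where "theta n (Suc m) R" "theta_edges n (Suc m) R \<subseteq> E"
      by (rule theta_grow[OF Q(1) n(1) m3 Q(2) sym len[unfolded n(2)] ear])
    then have "?P (Suc m)" using m3 by auto
    from m(2)[OF this] show thesis by simp
  qed
qed

section \<open>The characterisation\<close>

lemma cyc_iso_length:
  assumes K: "pair_wf_digraph K" and iso: "digraph_iso (with_proj K) (with_proj B)"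
    and c: "cyc (parcs K) xs" and len: "\<And>ys. cyc (parcs B) ys \<Longrightarrow> length ys = r"
  shows "length xs = r"
proof -
  interpret pair_wf_digraph K by fact
  obtain h where h: "inj_on h (pverts K)" "parcs B = map_prod h h ` parcs K"
    using iso unfolding digraph_iso_with_proj_iff[OF K] by blast
  have "set xs \<subseteq> pverts K"
    using cyc_set_in_Field[OF c] by (auto simp: Field_def dest: in_arcsD1 in_arcsD2)
  then have "inj_on h (set xs)" by (rule inj_on_subset[OF h(1)])
  then have "cyc (parcs B) (map h xs)" by (rule cyc_map[OF c]) (simp add: h(2))
  from len[OF this] show ?thesis by simp
qed

lemma cycle_iso_cycle_graph:
  assumes "pair_wf_digraph K" "pverts K = set xs" "parcs K = arcs_cyc xs \<union> (arcs_cyc xs)\<inverse>"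
    and "distinct xs" "length xs = r"
  shows "digraph_iso (with_proj K) (with_proj (cycle_graph r))"
proof -
  obtain h where h: "inj_on h ((!) xs ` {..<r})" "\<And>i. i \<in> {..<r} \<Longrightarrow> h (xs ! i) = i"
    by (rule same_kernel_inj[of "{..<r}" "(!) xs" "\<lambda>i. i"]) (use assms(4,5) in \<open>auto simp: nth_eq_iff_index_eq\<close>)
  have xs: "set xs = (!) xs ` {..<r}" using assms(5) by (auto simp: set_conv_nth)
  define A where "A = (\<lambda>i. (i, Suc i mod r)) ` {..<r}"
  have "arcs_cyc xs = (\<lambda>i. (xs ! i, xs ! (Suc i mod r))) ` {..<r}"
    unfolding arcs_cyc_nth assms(5) by auto
  then have "map_prod h h ` arcs_cyc xs = (\<lambda>i. (h (xs ! i), h (xs ! (Suc i mod r)))) ` {..<r}"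
    by (simp only: image_image map_prod_simp)
  also have "\<dots> = A" unfolding A_def using h(2) by (intro image_cong) auto
  finally have arcs: "map_prod h h ` arcs_cyc xs = A" .
  have "{(i, Suc i mod r) | i. i < r} = A" unfolding A_def by auto
  then have "parcs (cycle_graph r) = A \<union> A\<inverse>"
    unfolding cycle_graph_def Let_def by (simp only: pair_pre_digraph.select_convs)
  also have "\<dots> = map_prod h h ` parcs K"
    unfolding assms(3) image_Un arcs[symmetric] by force
  finally have "parcs (cycle_graph r) = map_prod h h ` parcs K" .
  moreover have "pverts (cycle_graph r) = h ` pverts K"
    using h(2) by (auto simp: cycle_graph_def Let_def assms(2) xs image_image)
  moreover have "inj_on h (pverts K)" using h(1) by (simp add: assms(2) xs)
  ultimately show ?thesis unfolding digraph_iso_with_proj_iff[OF assms(1)] by blast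
qed

lemma theta_iso_book_graph:
  assumes "pair_wf_digraph K" "theta n (Suc p) Q" "pverts K = theta_verts n (Suc p) Q"
    "parcs K = theta_edges n (Suc p) Q" "0 < n" "0 < p"
  shows "digraph_iso (with_proj K) (with_proj (book_graph n (2 * n) p))"
proof -
  obtain h where "inj_on h (theta_verts n (Suc p) Q)"
    "theta_verts n (Suc p) (book_path n) = h ` theta_verts n (Suc p) Q"
    "theta_edges n (Suc p) (book_path n) = map_prod h h ` theta_edges n (Suc p) Q"
    using assms(2) theta_book_path by (rule theta_iso)
  then show ?thesis
    unfolding digraph_iso_with_proj_iff[OF assms(1)] verts_book_graph[OF assms(5,6)]
      arcs_book_graph[OF assms(5,6)] assms(3,4) by blast
qed

lemma book_graph_cyc_length:
  assumes "2 \<le> n" "0 < p" "cyc (parcs (book_graph n (2 * n) p)) xs"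
  shows "length xs = 2 * n"
  using theta_cyc_length[OF theta_book_path assms(1)] assms by (simp add: arcs_book_graph)

theorem theorem3p14:
  fixes G :: "'a pair_pre_digraph" and r :: nat
  assumes "pair_graph G"
    and "Digraph_Component.connected (with_proj G)"
    and "planar G"
    and "\<exists>c. ugraph_cycle (with_proj G) c"
    and "r \<ge> 3"
  shows "(r = girth (with_proj G) \<and> girth (with_proj G) = circum (with_proj G)) \<longleftrightarrow>
    (even r \<and> (\<forall>H. block (with_proj (bridgeless_part G)) H \<longrightarrow>
        (\<exists>p\<ge>2. digraph_iso H (with_proj (book_graph (r div 2) r p))) \<or>
        digraph_iso H (with_proj (cycle_graph r))))
    \<or> (odd r \<and> (\<forall>H. block (with_proj (bridgeless_part G)) H \<longrightarrow>
        digraph_iso H (with_proj (cycle_graph r))))"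
    (is "?girth \<longleftrightarrow> ?blocks")
proof -
  interpret pair_graph G by fact
  let ?B = "with_proj (bridgeless_part G)"
  let ?book = "\<lambda>H. \<exists>p\<ge>2. digraph_iso H (with_proj (book_graph (r div 2) r p))"
  let ?cycle = "\<lambda>H. digraph_iso H (with_proj (cycle_graph r))"
  have girth: "?girth \<longleftrightarrow> (\<forall>xs. cyc (parcs G) xs \<longrightarrow> length xs = r)"
    using assms(4) by (rule girth_circum_iff)
  have blocks: "even r \<and> ?book H \<or> ?cycle H"
    if len: "\<forall>xs. cyc (parcs G) xs \<longrightarrow> length xs = r" and H: "block ?B H" for H
  proof -
    obtain K xs where K: "H = with_proj K" "psub K G" "biconn (pverts K) (parcs K)" "cyc (parcs K) xs"
      using H by (rule block_bridgeless_partE)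
    interpret K: pair_graph K using K(2) by (simp add: psub_def)
    have wf: "pair_wf_digraph K" by (rule K.pair_wf_digraph)
    have lenK: "length ys = r" if "cyc (parcs K) ys" for ys
      using len that cyc_mono K(2) unfolding psub_def by blast
    have irr: "u \<noteq> v" if "(u, v) \<in> parcs K" for u v using K.no_loops' that by blast
    have EV: "parcs K \<subseteq> pverts K \<times> pverts K" by (auto dest: K.in_arcsD1 K.in_arcsD2)
    from K(3) K.sym_parcs irr EV K.pair_finite_verts lenK K(4) show ?thesis
    proof (rule biconn_equal_cycles_structure)
      assume "pverts K = set xs" "parcs K = arcs_cyc xs \<union> (arcs_cyc xs)\<inverse>"
      then show ?thesis
        using cycle_iso_cycle_graph[OF wf] K(1,4) lenK[OF K(4)] by (simp add: cyc_def)
    next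
      fix n m Q
      assume *: "2 \<le> n" "3 \<le> m" "r = 2 * n" "theta n m Q"
        "pverts K = theta_verts n m Q" "parcs K = theta_edges n m Q"
      obtain p where p: "m = Suc p" "2 \<le> p" using *(2) by (cases m) auto
      have "digraph_iso H (with_proj (book_graph n (2 * n) p))"
        unfolding K(1) using * p by (intro theta_iso_book_graph[OF wf]) auto
      then show ?thesis using *(3) p(2) by auto
    qed
  qed
  have cycles: "length xs = r"
    if iso: "\<forall>H. block ?B H \<longrightarrow> even r \<and> ?book H \<or> ?cycle H" and xs: "cyc (parcs G) xs" for xs
  proof -
    obtain K where K: "block ?B (with_proj K)" "pair_graph K" "cyc (parcs K) xs"
      using xs by (rule block_of_cyc)
    interpret K: pair_graph K by fact
    have wf: "pair_wf_digraph K" by (rule K.pair_wf_digraph)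
    from iso K(1) have "even r \<and> ?book (with_proj K) \<or> ?cycle (with_proj K)" by blast
    then show ?thesis
    proof
      assume "even r \<and> ?book (with_proj K)"
      then obtain p where p: "even r" "2 \<le> p" "digraph_iso (with_proj K) (with_proj (book_graph (r div 2) r p))"
        by blast
      \<comment> \<open>An even \<open>r\<close> with \<open>r >= 3\<close> is at least 4, which
        supplies the bound that \<open>book_graph_cyc_length\<close> asks for.\<close>
      obtain n where n: "r = 2 * n" "2 \<le> n" using p(1) assms(5) by (auto elim!: evenE)
      show ?thesis
      proof (rule cyc_iso_length[OF wf p(3) K(3)])
        fix ys assume "cyc (parcs (book_graph (r div 2) r p)) ys"
        then show "length ys = r" using book_graph_cyc_length[of n p ys] n p(2) by simp
      qed
    next
      assume "?cycle (with_proj K)"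
      from cyc_iso_length[OF wf this K(3) cycle_graph_cyc_length] show ?thesis .
    qed
  qed
  \<comment> \<open>Attaching the parity to the book alternative merges the two cases of the theorem
    into one condition on each block.\<close>
  have "?blocks \<longleftrightarrow> (\<forall>H. block ?B H \<longrightarrow> even r \<and> ?book H \<or> ?cycle H)"
    by (cases "even r") simp_all
  also have "\<dots> \<longleftrightarrow> (\<forall>xs. cyc (parcs G) xs \<longrightarrow> length xs = r)"
    (is "?l \<longleftrightarrow> ?r")
  proof
    show ?r if ?l using cycles[OF that] by blast
    show ?l if ?r using blocks[OF that] by blast
  qed
  finally show ?thesis unfolding girth by (rule sym)
qed


end
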